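(* Consider the uniform-controller branch (see context), and assume that for some $\mu>0$, $\|\nabla F(x)\|^2\ge2\mu(F(x)-F_\star)$ for every iterate $x$. Define $a_{\mathrm{PL}}:=\mu\frac{\vartheta}{L}-\beta_{\mathrm{dir}}$ and suppose $$a_{\mathrm{PL}}>0,\qquad a_{\mathrm{PL}}<1-C_q,\qquad a_{\mathrm{PL}}(1-C_q)>B_q\gamma_{\mathrm{dir}}.$$ Define $$\rho_{\mathrm{PL}}:=\frac{a_{\mathrm{PL}}+1-C_q-\sqrt{(1-C_q-a_{\mathrm{PL}})^2+4B_q\gamma_{\mathrm{dir}}}}{2},\qquad \lambda_{\mathrm{PL}}:=\frac{2\gamma_{\mathrm{dir}}}{1-C_q-a_{\mathrm{PL}}+\sqrt{(1-C_q-a_{\mathrm{PL}})^2+4B_q\gamma_{\mathrm{dir}}}}.$$ Then $s_t:=g_t+\lambda_{\mathrm{PL}}q_t$ satisfies, for every $t\ge0$, $$s_{t+1}\le(1-\rho_{\mathrm{PL}})s_t+\delta_{\mathrm{dir}}+\lambda_{\mathrm{PL}}A_q,$$ and therefore $$g_t\le(1-\rho_{\mathrm{PL}})^t\bigl(g_0+\lambda_{\mathrm{PL}}q_0\bigr)+\frac{\delta_{\mathrm{dir}}+\lambda_{\mathrm{PL}}A_q}{\rho_{\mathrm{PL}}}.$$ In the regime $2\mu\vartheta\le L$, $\vartheta^2\le\min\{\frac{\mu}{400L},\frac1{576}\}$, one has $$\rho_{\mathrm{PL}}\ge\frac{\mu\vartheta}{8L},\qquad \frac{\delta_{\mathrm{dir}}+\lambda_{\mathrm{PL}}A_q}{\rho_{\mathrm{PL}}}=O\!\left(\frac{\vartheta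 v^2}{\mu nHb}+\frac{\vartheta^2v^2}{\mu Hb}\right),$$ where $O(\cdot)$ hides an absolute constant.
   Context: Problem: $F(x)=\frac1n\sum_{i=1}^nF_i(x)$, $F_i(x)=\frac1{m_i}\sum_{j=1}^{m_i}\phi_{ij}(x)$, each $\phi_{ij}:\mathbb R^d\to\mathbb R$ convex and $L$-smooth ($L$-Lipschitz gradient). There are $x_\star\in\arg\min F$ and $R>0$; $B(x_\star,R)=\{x:\|x-x_\star\|\le R\}$, $F_\star:=F(x_\star)$. $v_i^2:=\sup_{x\in B(x_\star,R)}\frac1{m_i}\sum_j\|\nabla\phi_{ij}(x)-\nabla F_i(x)\|^2$, $v^2:=\max_iv_i^2$. Uniform-controller branch: all nodes are active in every round, with common horizon $H$, minibatch size $b$, amplitude $\vartheta\in(0,1]$ satisfying $288\vartheta^2<1$, and weights $1/n$. Concretely, $c_0=\frac1n\sum_ic_{i,0}$; in round $t\ge0$, each node $i\in[n]$ sets $\eta=\vartheta/(LH)$, $y_{i,t}^{(0)}=x_t$, and for $\ell=0,\dots,H-1$ draws a minibatch $\mathcal B_{i,t,\ell}\subseteq[m_i]$ of size $b$, computes $g_{i,t,\ell}=\frac1b\sum_{j\in\mathcal B_{i,t,\ell}}\nabla\phi_{ij}(y_{i,t}^{(\ell)})$ and sets $y_{i,t}^{(\ell+1)}=y_{i,t}^{(\ell)}-\eta(g_{i,t,\ell}-c_{i,t}+c_t)$; then $\Delta_{i,t}=y_{i,t}^{(H)}-x_t$, $c_{i,t+1}=c_{i,t}-c_t+\frac1{H\eta}(x_t-y_{i,t}^{(H)})$,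 $x_{t+1}=x_t+\frac1n\sum_i\Delta_{i,t}$, $c_{t+1}=c_t+\frac1n\sum_i(c_{i,t+1}-c_{i,t})$. Standing assumptions: almost surely $x_t,y_{i,t}^{(\ell)}\in B(x_\star,R)$ for all $t,i,\ell$. $\mathcal F_t$ is generated by the initial state and all minibatches drawn strictly before round $t$; $\mathcal G_{i,t,\ell}$ by $\mathcal F_t$ and all minibatches of node $i$ drawn strictly before local step $\ell$ of round $t$. Conditionally on $\mathcal G_{i,t,\ell}$ the minibatches are independent across nodes and local steps, $\mathbb E[g_{i,t,\ell}\mid\mathcal G_{i,t,\ell}]=\nabla F_i(y_{i,t}^{(\ell)})$ and $\mathbb E[\|g_{i,t,\ell}-\nabla F_i(y_{i,t}^{(\ell)})\|^2\mid\mathcal G_{i,t,\ell}]\le v_i^2/b$. Notation: $g_t:=\mathbb E[F(x_t)-F_\star]$, $e_{i,t}:=c_{i,t}-\nabla F_i(x_t)$, $q_t:=\max_i\mathbb E\|e_{i,t}\|^2$, $$\beta_{\mathrm{dir}}:=48\vartheta^3+\frac{32\vartheta^4}{n},\quad \gamma_{\mathrm{dir}}:=\frac{96\vartheta^3}{L}+\frac{64\vartheta^4}{Ln},\quad \delta_{\mathrm{dir}}:=\Bigl(16\vartheta^3+\frac{16\vartheta^2}{n}\Bigr)\frac{v^2}{LHb},$$ $$A_q:=\frac{6v^2}{Hb},\quad B_q:=144L\vartheta^2,\quad C_q:=288\vartheta^2.$$ *)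

theory Defs
  imports "HOL-Probability.Probability"
begin

definition grad :: "(real ^ 'd \<Rightarrow> real) \<Rightarrow> real ^ 'd \<Rightarrow> real ^ 'd" where
  "grad f x = (THE D. GDERIV f x :> D)"

definition L_smooth :: "real \<Rightarrow> (real ^ 'd \<Rightarrow> real) \<Rightarrow> bool" where
  "L_smooth L f \<longleftrightarrow> (\<forall>x. f differentiable (at x)) \<and> L-lipschitz_on UNIV (grad f)"

text \<open>Nodes are indexed by \<open>i < n\<close> and the components of node \<open>i\<close> by \<open>j < m i\<close>.\<close>

definition node_obj ::
  "(nat \<Rightarrow> nat) \<Rightarrow> (nat \<Rightarrow> nat \<Rightarrow> real ^ 'd \<Rightarrow> real) \<Rightarrow> nat \<Rightarrow> real ^ 'd \<Rightarrow> real" where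
  "node_obj m \<phi> i x = (1 / real (m i)) * (\<Sum>j<m i. \<phi> i j x)"

definition global_obj ::
  "nat \<Rightarrow> (nat \<Rightarrow> nat) \<Rightarrow> (nat \<Rightarrow> nat \<Rightarrow> real ^ 'd \<Rightarrow> real) \<Rightarrow> real ^ 'd \<Rightarrow> real" where
  "global_obj n m \<phi> x = (1 / real n) * (\<Sum>i<n. node_obj m \<phi> i x)"

text \<open>\<open>node_var\<close> and \<open>max_var\<close> are the squared quantities $v_i^2$ and $v^2$.\<close>

definition node_var ::
  "(nat \<Rightarrow> nat) \<Rightarrow> (nat \<Rightarrow> nat \<Rightarrow> real ^ 'd \<Rightarrow> real) \<Rightarrow> real ^ 'd \<Rightarrow> real \<Rightarrow> nat \<Rightarrow> real" where
  "node_var m \<phi> xstar R i =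
     (SUP x\<in>cball xstar R.
        (1 / real (m i)) * (\<Sum>j<m i. (norm (grad (\<phi> i j) x - grad (node_obj m \<phi> i) x))\<^sup>2))"

definition max_var ::
  "nat \<Rightarrow> (nat \<Rightarrow> nat) \<Rightarrow> (nat \<Rightarrow> nat \<Rightarrow> real ^ 'd \<Rightarrow> real) \<Rightarrow> real ^ 'd \<Rightarrow> real \<Rightarrow> real" where
  "max_var n m \<phi> xstar R = Max (node_var m \<phi> xstar R ` {..<n})"

text \<open>\<open>Bat i t l\<close> is the random minibatch of node \<open>i\<close> at local step \<open>l < H\<close> of round \<open>t\<close>. The
  initial state consists of \<open>x0\<close> and the node controls \<open>c0 i\<close>; their average is determined by
  these.\<close>

definition round_algebra ::
  "'w measure \<Rightarrow> nat \<Rightarrow> nat \<Rightarrow> ('w \<Rightarrow> real ^ 'd) \<Rightarrow> (nat \<Rightarrow> 'w \<Rightarrow> real ^ 'd) \<Rightarrow>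
   (nat \<Rightarrow> nat \<Rightarrow> nat \<Rightarrow> 'w \<Rightarrow> nat set) \<Rightarrow> nat \<Rightarrow> 'w measure" where
  "round_algebra M n H x0 c0 Bat t = sigma (space M)
     ({x0 -` A \<inter> space M | A. A \<in> sets borel} \<union>
      {c0 i -` A \<inter> space M | i A. i < n \<and> A \<in> sets borel} \<union>
      {Bat i s l -` A \<inter> space M | i s l A. i < n \<and> s < t \<and> l < H})"

definition step_algebra ::
  "'w measure \<Rightarrow> nat \<Rightarrow> nat \<Rightarrow> ('w \<Rightarrow> real ^ 'd) \<Rightarrow> (nat \<Rightarrow> 'w \<Rightarrow> real ^ 'd) \<Rightarrow>
   (nat \<Rightarrow> nat \<Rightarrow> nat \<Rightarrow> 'w \<Rightarrow> nat set) \<Rightarrow> nat \<Rightarrow> nat \<Rightarrow> nat \<Rightarrow> 'w measure" where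
  "step_algebra M n H x0 c0 Bat i t l = sigma (space M)
     (sets (round_algebra M n H x0 c0 Bat t) \<union>
      {Bat i t k -` A \<inter> space M | k A. k < l})"

text \<open>Mutual conditional independence, given the sub-\<open>\<sigma>\<close>-algebra \<open>G\<close>, of a family of discrete
  random variables (every set of values is an event).\<close>

definition cond_indep_discrete ::
  "'w measure \<Rightarrow> 'w measure \<Rightarrow> ('k \<Rightarrow> 'w \<Rightarrow> 'c) \<Rightarrow> 'k set \<Rightarrow> bool" where
  "cond_indep_discrete M G X I \<longleftrightarrow>
     (\<forall>J A. J \<subseteq> I \<and> finite J \<longrightarrow>
        (AE w in M. real_cond_exp M G (\<lambda>w. \<Prod>k\<in>J. indicator (A k) (X k w)) w =
                    (\<Prod>k\<in>J. real_cond_exp M G (\<lambda>w. indicator (A k) (X k w)) w)))"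

definition vec_cond_exp ::
  "'w measure \<Rightarrow> 'w measure \<Rightarrow> ('w \<Rightarrow> real ^ 'd) \<Rightarrow> 'w \<Rightarrow> real ^ 'd" where
  "vec_cond_exp M G X w = (\<chi> k. real_cond_exp M G (\<lambda>w. X w $ k) w)"

definition obj_gap :: "'w measure \<Rightarrow> (real ^ 'd \<Rightarrow> real) \<Rightarrow> real ^ 'd \<Rightarrow> (nat \<Rightarrow> 'w \<Rightarrow> real ^ 'd) \<Rightarrow>
   nat \<Rightarrow> real" where
  "obj_gap M F xstar x t = (\<integral>w. F (x t w) - F xstar \<partial>M)"

text \<open>\<open>max_mean_sq\<close> is extended-real valued: no second moment of the initial controls is assumed,
  so its value at \<open>t = 0\<close> can be \<open>\<infinity>\<close>. The Bochner integral would return \<open>0\<close> there.\<close>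

definition max_mean_sq :: "'w measure \<Rightarrow> nat \<Rightarrow> (nat \<Rightarrow> nat \<Rightarrow> 'w \<Rightarrow> real ^ 'd) \<Rightarrow> nat \<Rightarrow> ereal" where
  "max_mean_sq M n e t =
     Max ((\<lambda>i. enn2ereal (\<integral>\<^sup>+w. ennreal ((norm (e i t w))\<^sup>2) \<partial>M)) ` {..<n})"

text \<open>In the constants below, arguments named \<open>v2\<close> stand for $v^2$.\<close>

definition beta_dir :: "real \<Rightarrow> nat \<Rightarrow> real" where
  "beta_dir \<theta> n = 48 * \<theta> ^ 3 + 32 * \<theta> ^ 4 / real n"

definition gamma_dir :: "real \<Rightarrow> real \<Rightarrow> nat \<Rightarrow> real" where
  "gamma_dir L \<theta> n = 96 * \<theta> ^ 3 / L + 64 * \<theta> ^ 4 / (L * real n)"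

definition delta_dir :: "real \<Rightarrow> real \<Rightarrow> nat \<Rightarrow> nat \<Rightarrow> nat \<Rightarrow> real \<Rightarrow> real" where
  "delta_dir L \<theta> n H b v2 =
     (16 * \<theta> ^ 3 + 16 * \<theta>\<^sup>2 / real n) * (v2 / (L * real H * real b))"

definition A_q :: "nat \<Rightarrow> nat \<Rightarrow> real \<Rightarrow> real" where
  "A_q H b v2 = 6 * v2 / (real H * real b)"

definition B_q :: "real \<Rightarrow> real \<Rightarrow> real" where
  "B_q L \<theta> = 144 * L * \<theta>\<^sup>2"

definition C_q :: "real \<Rightarrow> real" where
  "C_q \<theta> = 288 * \<theta>\<^sup>2"

definition a_PL :: "real \<Rightarrow> real \<Rightarrow> real \<Rightarrow> nat \<Rightarrow> real" where
  "a_PL \<mu> L \<theta> n = \<mu> * (\<theta> / L) - beta_dir \<theta> n"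

definition rho_PL :: "real \<Rightarrow> real \<Rightarrow> real \<Rightarrow> nat \<Rightarrow> real" where
  "rho_PL \<mu> L \<theta> n =
     (a_PL \<mu> L \<theta> n + 1 - C_q \<theta> -
       sqrt ((1 - C_q \<theta> - a_PL \<mu> L \<theta> n)\<^sup>2 + 4 * B_q L \<theta> * gamma_dir L \<theta> n)) / 2"

definition lambda_PL :: "real \<Rightarrow> real \<Rightarrow> real \<Rightarrow> nat \<Rightarrow> real" where
  "lambda_PL \<mu> L \<theta> n =
     2 * gamma_dir L \<theta> n /
     (1 - C_q \<theta> - a_PL \<mu> L \<theta> n +
       sqrt ((1 - C_q \<theta> - a_PL \<mu> L \<theta> n)\<^sup>2 + 4 * B_q L \<theta> * gamma_dir L \<theta> n))"

definition PL_admissible :: "real \<Rightarrow> real \<Rightarrow> real \<Rightarrow> nat \<Rightarrow> bool" where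
  "PL_admissible \<mu> L \<theta> n \<longleftrightarrow>
     a_PL \<mu> L \<theta> n > 0 \<and> a_PL \<mu> L \<theta> n < 1 - C_q \<theta> \<and>
     a_PL \<mu> L \<theta> n * (1 - C_q \<theta>) > B_q L \<theta> * gamma_dir L \<theta> n"

definition PL_regime :: "real \<Rightarrow> real \<Rightarrow> real \<Rightarrow> bool" where
  "PL_regime \<mu> L \<theta> \<longleftrightarrow> 2 * \<mu> * \<theta> \<le> L \<and> \<theta>\<^sup>2 \<le> min (\<mu> / (400 * L)) (1 / 576)"

end

theory Submission
  imports Defs
begin

text \<open>
  Why the theorem holds. Write \<open>Q\<close> for a common bound on the second moments of the control errors
  \<open>c_i - \<nabla>F_i(x)\<close> at the start of a round and \<open>gap\<close> for the expected objective gap. Both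
  quantities satisfy a linear recursion over one round, and \<open>lambda_PL\<close> is chosen so that
  \<open>gap + lambda_PL Q\<close> contracts by the factor \<open>1 - rho_PL\<close>.

  The local drift comes first. A local step of a node moves along the gradient noise, the change of the
  local gradient since the start of the round, the control errors and the global gradient. As the steps
  have total length \<open>\<theta>/L\<close> and \<open>288 \<theta>\<^sup>2 < 1\<close>, strong induction on the local step bounds
  \<open>L\<^sup>2 E|y - x|\<^sup>2\<close> by \<open>drift_bound\<close> (lemma \<open>drift_le\<close>). The new control of a node is the
  average of its stochastic gradients, so that its error consists of averaged noise and drift
  (lemma \<open>err_recursion\<close>).

  The server moves from \<open>x\<close> to \<open>x - (\<theta>/L) cbar\<close>, where \<open>cbar\<close> is the average of the new
  controls. Splitting \<open>cbar\<close> into the average gradient and the average noise, the descent lemma for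
  \<open>L\<close>-smooth functions and the Polyak-Lojasiewicz inequality give the recursion of the gap
  (lemma \<open>gap_recursion\<close>). The noise of a step has mean zero given the past of the same node,
  and noises of different nodes are uncorrelated because the batches are conditionally independent
  given the past of the round (lemma \<open>noise_uncorrelated_nodes\<close>). This is the source of the
  factor \<open>1/n\<close> in \<open>delta_dir\<close>.

  The last two claims concern real numbers only. With \<open>a\<close>, \<open>B\<close>, \<open>C\<close> and \<open>\<gamma>\<close> standing for \<open>a_PL\<close>,
  \<open>B_q\<close>, \<open>C_q\<close> and \<open>gamma_dir\<close>, the rate \<open>rho_PL\<close> is the smaller root of
  \<open>(a - r) (1 - C - r) = B \<gamma>\<close>, and evaluating this polynomial at \<open>\<mu>\<theta>/(8L)\<close> bounds it from below.
  The stationary term is then of the stated order because \<open>lambda_PL\<close> is at most an absolute multiple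
  of \<open>\<theta>\<^sup>3/L\<close> (lemma \<open>lambda_PL_regime_le\<close>).
\<close>

section \<open>The contraction factor and the Lyapunov weight\<close>

lemma beta_dir_nonneg: "0 \<le> \<theta> \<Longrightarrow> 0 \<le> beta_dir \<theta> n"
  by (simp add: beta_dir_def)

lemma gamma_dir_pos: "0 < \<theta> \<Longrightarrow> 0 < L \<Longrightarrow> 0 < gamma_dir L \<theta> n"
  unfolding gamma_dir_def by (intro add_pos_nonneg) auto

lemma B_q_pos: "0 < \<theta> \<Longrightarrow> 0 < L \<Longrightarrow> 0 < B_q L \<theta>"
  by (simp add: B_q_def)

context
  fixes \<mu> L \<theta> :: real and n :: nat
  assumes pos: "0 < L" "0 < \<theta>" and adm: "PL_admissible \<mu> L \<theta> n"
begin

lemma lambda_PL_pos: "0 < lambda_PL \<mu> L \<theta> n"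
proof -
  have "0 < 1 - C_q \<theta> - a_PL \<mu> L \<theta> n" using adm by (simp add: PL_admissible_def)
  moreover have "0 \<le> sqrt ((1 - C_q \<theta> - a_PL \<mu> L \<theta> n)\<^sup>2 + 4 * B_q L \<theta> * gamma_dir L \<theta> n)"
    using B_q_pos[OF pos(2,1)] gamma_dir_pos[OF pos(2,1), of n] by simp
  ultimately show ?thesis
    unfolding lambda_PL_def using gamma_dir_pos[OF pos(2,1)]
    by (intro divide_pos_pos add_pos_nonneg) (simp_all only: mult_pos_pos zero_less_numeral)
qed

text \<open>The weight \<open>lambda_PL\<close> is the positive root of \<open>B \<lambda>\<^sup>2 + (1 - C - a) \<lambda> = \<gamma>\<close>; this quadratic
  says that \<open>(1, \<lambda>)\<close> is a left eigenvector, with eigenvalue \<open>1 - \<rho>\<close>, of the matrix with rows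
  \<open>(1 - a, \<gamma>)\<close> and \<open>(B, C)\<close> that governs the pair (objective gap, control error).\<close>

lemma rho_PL_eq: "rho_PL \<mu> L \<theta> n = a_PL \<mu> L \<theta> n - lambda_PL \<mu> L \<theta> n * B_q L \<theta>"
  and lambda_PL_eigen:
    "gamma_dir L \<theta> n + lambda_PL \<mu> L \<theta> n * C_q \<theta> = (1 - rho_PL \<mu> L \<theta> n) * lambda_PL \<mu> L \<theta> n"
proof -
  define a where "a = a_PL \<mu> L \<theta> n"
  define C where "C = C_q \<theta>"
  define B where "B = B_q L \<theta>"
  define \<gamma> where "\<gamma> = gamma_dir L \<theta> n"
  define D where "D = 1 - C - a"
  define S where "S = sqrt (D\<^sup>2 + 4 * B * \<gamma>)"
  have D: "0 < D" using adm by (simp add: D_def a_def C_def PL_admissible_def)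
  have BG: "0 < B" "0 < \<gamma>" using B_q_pos[OF pos(2,1)] gamma_dir_pos[OF pos(2,1)]
    by (auto simp: B_def \<gamma>_def)
  have S2: "S\<^sup>2 = D\<^sup>2 + 4 * B * \<gamma>" unfolding S_def using BG by simp
  have S0: "0 \<le> S" unfolding S_def using BG by simp
  have lam: "lambda_PL \<mu> L \<theta> n = 2 * \<gamma> / (D + S)"
    unfolding lambda_PL_def by (simp add: S_def D_def a_def C_def B_def \<gamma>_def)
  have rho: "rho_PL \<mu> L \<theta> n = (a + 1 - C - S) / 2"
    unfolding rho_PL_def by (simp add: S_def D_def a_def C_def B_def \<gamma>_def)
  define l where "l = 2 * \<gamma> / (D + S)"
  have "l * (D + S) = 2 * \<gamma>" using D S0 by (simp add: l_def)
  moreover have "2 * B * l = S - D"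
  proof -
    have "(S - D) * (D + S) = 2 * B * (2 * \<gamma>)"
      using S2 by (simp add: algebra_simps power2_eq_square)
    then have "S - D = 2 * B * (2 * \<gamma>) / (D + S)" using D S0 by (simp add: field_simps)
    then show ?thesis by (simp add: l_def)
  qed
  ultimately show "rho_PL \<mu> L \<theta> n = a_PL \<mu> L \<theta> n - lambda_PL \<mu> L \<theta> n * B_q L \<theta>"
    and "gamma_dir L \<theta> n + lambda_PL \<mu> L \<theta> n * C_q \<theta> = (1 - rho_PL \<mu> L \<theta> n) * lambda_PL \<mu> L \<theta> n"
    unfolding lam rho l_def[symmetric] a_def[symmetric] B_def[symmetric] \<gamma>_def[symmetric] C_def[symmetric]
    by (auto simp: D_def field_simps)
qed

lemma rho_PL_less_1: "rho_PL \<mu> L \<theta> n < 1"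
proof -
  have "rho_PL \<mu> L \<theta> n \<le> a_PL \<mu> L \<theta> n"
    unfolding rho_PL_eq using lambda_PL_pos B_q_pos[OF pos(2,1)] by simp
  also have "\<dots> < 1" using adm by (simp add: PL_admissible_def C_q_def)
      (smt (verit) zero_le_power2)
  finally show ?thesis .
qed

text \<open>The rate \<open>\<rho>\<close> is the smaller root of \<open>(a - r) (1 - C - r) = B \<gamma>\<close>, so that a number below \<open>1 - C\<close>
  at which the left hand side is at least \<open>B \<gamma>\<close> does not exceed \<open>\<rho>\<close>.\<close>

lemma rho_PL_ge:
  assumes r: "r < 1 - C_q \<theta>"
    and char: "(a_PL \<mu> L \<theta> n - r) * (1 - C_q \<theta> - r) \<ge> B_q L \<theta> * gamma_dir L \<theta> n"
  shows "r \<le> rho_PL \<mu> L \<theta> n"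
proof (rule ccontr)
  define a where "a = a_PL \<mu> L \<theta> n"
  define C where "C = C_q \<theta>"
  define B where "B = B_q L \<theta>"
  define \<gamma> where "\<gamma> = gamma_dir L \<theta> n"
  define l where "l = lambda_PL \<mu> L \<theta> n"
  define p where "p = rho_PL \<mu> L \<theta> n"
  have BG: "0 < B" "0 < \<gamma>" using B_q_pos[OF pos(2,1)] gamma_dir_pos[OF pos(2,1)]
    by (auto simp: B_def \<gamma>_def)
  have l: "0 < l" using lambda_PL_pos by (simp add: l_def)
  have e1: "a - p = l * B" using rho_PL_eq by (simp add: a_def p_def l_def B_def)
  have e2: "l * (1 - C - p) = \<gamma>" using lambda_PL_eigen
    by (simp add: \<gamma>_def p_def l_def C_def algebra_simps)
  have e3: "(a - p) * (1 - C - p) = B * \<gamma>" by (simp add: e1 e2[symmetric])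
  assume "\<not> r \<le> rho_PL \<mu> L \<theta> n"
  then have rp: "p < r" by (simp add: p_def)
  have "(a - r) * (1 - C - r) < (a - p) * (1 - C - p)"
  proof -
    have "(a - r) * (1 - C - r) \<le> (a - p) * (1 - C - r)"
      using rp r by (intro mult_right_mono) (auto simp: C_def)
    also have "\<dots> < (a - p) * (1 - C - p)"
      using rp l BG e1 by (intro mult_strict_left_mono) auto
    finally show ?thesis .
  qed
  with char e3 show False by (simp add: a_def C_def B_def \<gamma>_def)
qed

lemma rho_PL_pos: "0 < rho_PL \<mu> L \<theta> n"
proof -
  have "a_PL \<mu> L \<theta> n > 0" "1 - C_q \<theta> > 0"
    "a_PL \<mu> L \<theta> n * (1 - C_q \<theta>) > B_q L \<theta> * gamma_dir L \<theta> n"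
    using adm by (auto simp: PL_admissible_def)
  moreover have "0 \<le> rho_PL \<mu> L \<theta> n" using calculation by (intro rho_PL_ge) auto
  moreover have "rho_PL \<mu> L \<theta> n \<noteq> 0"
  proof
    assume 0: "rho_PL \<mu> L \<theta> n = 0"
    have "a_PL \<mu> L \<theta> n = lambda_PL \<mu> L \<theta> n * B_q L \<theta>" using rho_PL_eq 0 by simp
    moreover have "gamma_dir L \<theta> n = lambda_PL \<mu> L \<theta> n * (1 - C_q \<theta>)"
      using lambda_PL_eigen 0 by (simp add: algebra_simps)
    ultimately have "a_PL \<mu> L \<theta> n * (1 - C_q \<theta>) = B_q L \<theta> * gamma_dir L \<theta> n" by simp
    then show False using adm by (simp add: PL_admissible_def)
  qed
  ultimately show ?thesis by simp
qed

end

lemma regime_bounds: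
  assumes "0 < \<mu>" "0 < L" "0 < \<theta>" "0 < n" and reg: "PL_regime \<mu> L \<theta>"
  shows "\<theta> \<le> 1 / 24" "\<mu> * \<theta> / L \<le> 1 / 2" "400 * \<theta> ^ 3 \<le> \<mu> * \<theta> / L" "C_q \<theta> \<le> 1 / 2"
    "beta_dir \<theta> n \<le> 50 * \<theta> ^ 3" "gamma_dir L \<theta> n \<le> 99 * \<theta> ^ 3 / L"
proof -
  have "\<theta>\<^sup>2 \<le> (1 / 24)\<^sup>2" using reg by (simp add: PL_regime_def power2_eq_square)
  then show t: "\<theta> \<le> 1 / 24" by (rule power2_le_imp_le) simp
  show "\<mu> * \<theta> / L \<le> 1 / 2" using reg \<open>0 < L\<close> by (simp add: PL_regime_def field_simps)
  have "\<theta>\<^sup>2 * \<theta> \<le> \<mu> / (400 * L) * \<theta>"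
    using reg \<open>0 < \<theta>\<close> by (intro mult_right_mono) (auto simp: PL_regime_def)
  then show "400 * \<theta> ^ 3 \<le> \<mu> * \<theta> / L" using \<open>0 < L\<close>
    by (simp add: field_simps power3_eq_cube power2_eq_square)
  show "C_q \<theta> \<le> 1 / 2" using reg by (simp add: PL_regime_def C_q_def)
  have q: "\<theta> ^ 4 / real n \<le> \<theta> ^ 3 / 24"
  proof -
    have "\<theta> ^ 4 / real n \<le> \<theta> ^ 4 / 1"
      using \<open>0 < n\<close> \<open>0 < \<theta>\<close> by (intro divide_left_mono) auto
    also have "\<dots> = \<theta> ^ 3 * \<theta>" by (simp add: power_numeral_reduce)
    also have "\<dots> \<le> \<theta> ^ 3 * (1 / 24)" using t \<open>0 < \<theta>\<close> by (intro mult_left_mono) auto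
    finally show ?thesis by simp
  qed
  have th3: "0 < \<theta> ^ 3" using \<open>0 < \<theta>\<close> by simp
  have "beta_dir \<theta> n = 48 * \<theta> ^ 3 + 32 * (\<theta> ^ 4 / real n)" by (simp add: beta_dir_def)
  then show "beta_dir \<theta> n \<le> 50 * \<theta> ^ 3" using q th3 by linarith
  have "gamma_dir L \<theta> n = (96 * \<theta> ^ 3 + 64 * (\<theta> ^ 4 / real n)) / L"
    unfolding gamma_dir_def by (simp add: add_divide_distrib)
  also have "\<dots> \<le> 99 * \<theta> ^ 3 / L" using q th3 \<open>0 < L\<close> by (intro divide_right_mono) linarith+
  finally show "gamma_dir L \<theta> n \<le> 99 * \<theta> ^ 3 / L" .
qed

lemma rho_PL_regime_ge:
  assumes "0 < \<mu>" "0 < L" "0 < \<theta>" "0 < n" and adm: "PL_admissible \<mu> L \<theta> n"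
    and reg: "PL_regime \<mu> L \<theta>"
  shows "\<mu> * \<theta> / (8 * L) \<le> rho_PL \<mu> L \<theta> n"
proof -
  note b = regime_bounds[OF assms(1-4) reg]
  define u where "u = \<mu> * \<theta> / L"
  have u: "0 < u" "u \<le> 1 / 2" "400 * \<theta> ^ 3 \<le> u" using b assms by (auto simp: u_def)
  have "u / 8 \<le> rho_PL \<mu> L \<theta> n"
  proof (rule rho_PL_ge[OF assms(2,3) adm])
    show "u / 8 < 1 - C_q \<theta>" using u b(4) by simp
    have a: "a_PL \<mu> L \<theta> n - u / 8 \<ge> 3 / 4 * u"
      unfolding a_PL_def using b(5) u by (simp add: u_def)
    have "B_q L \<theta> * gamma_dir L \<theta> n \<le> B_q L \<theta> * (99 * \<theta> ^ 3 / L)"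
      using b(6) B_q_pos[OF assms(3,2)] by (intro mult_left_mono) auto
    also have "\<dots> = 14256 * (\<theta> ^ 3 * \<theta>\<^sup>2)" using assms by (simp add: B_q_def)
    also have "\<dots> \<le> 14256 * (u / 400 * (1 / 576))"
      using u reg by (intro mult_left_mono mult_mono) (auto simp: PL_regime_def)
    also have "\<dots> \<le> (3 / 4 * u) * (7 / 16)" using u by simp
    also have "\<dots> \<le> (a_PL \<mu> L \<theta> n - u / 8) * (1 - C_q \<theta> - u / 8)"
      using a u b(4) by (intro mult_mono) auto
    finally show "B_q L \<theta> * gamma_dir L \<theta> n \<le> (a_PL \<mu> L \<theta> n - u / 8) * (1 - C_q \<theta> - u / 8)" .
  qed
  then show ?thesis by (simp add: u_def mult.commute)
qed

text \<open>The gap between the diagonal entries \<open>1 - a\<close> and \<open>C\<close> is bounded below by an absolute constant: away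
  from \<open>\<theta> = 1 / 24\<close>, the largest amplitude in the regime, because \<open>C\<close> is small, and close to it because
  of the cubic term in \<open>beta_dir\<close>.\<close>

lemma regime_diagonal_gap:
  assumes "0 < \<mu>" "0 < L" "0 < \<theta>" "0 < n" and reg: "PL_regime \<mu> L \<theta>"
  shows "1 / 2304 \<le> 1 - C_q \<theta> - a_PL \<mu> L \<theta> n"
proof -
  note b = regime_bounds[OF assms(1-4) reg]
  have beta: "48 * \<theta> ^ 3 \<le> beta_dir \<theta> n" using assms by (simp add: beta_dir_def)
  show ?thesis
  proof (cases "\<theta> \<le> 1 / 48")
    case True
    have "\<theta>\<^sup>2 \<le> (1 / 48)\<^sup>2" using True assms by (intro power_mono) auto
    then have "C_q \<theta> \<le> 1 / 8" by (simp add: C_q_def power2_eq_square)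
    moreover have "a_PL \<mu> L \<theta> n \<le> 1 / 2"
      using b(2) beta_dir_nonneg[of \<theta> n] assms(3) by (simp add: a_PL_def del: le_divide_eq_numeral1)
    ultimately show ?thesis by simp
  next
    case False
    then have "(1 / 48) ^ 3 \<le> \<theta> ^ 3" by (intro power_mono) auto
    then have "1 / 2304 \<le> beta_dir \<theta> n" using beta by (simp add: power3_eq_cube)
    then show ?thesis using b(2,4) by (simp add: a_PL_def)
  qed
qed

lemma lambda_PL_regime_le:
  assumes "0 < \<mu>" "0 < L" "0 < \<theta>" "0 < n" and adm: "PL_admissible \<mu> L \<theta> n"
    and reg: "PL_regime \<mu> L \<theta>"
  shows "lambda_PL \<mu> L \<theta> n \<le> 2304 * 99 * \<theta> ^ 3 / L"
proof -
  define D where "D = 1 - C_q \<theta> - a_PL \<mu> L \<theta> n"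
  have D: "1 / 2304 \<le> D" using regime_diagonal_gap[OF assms(1-4) reg] by (simp add: D_def)
  have g: "0 < gamma_dir L \<theta> n" "gamma_dir L \<theta> n \<le> 99 * \<theta> ^ 3 / L"
    using gamma_dir_pos[OF assms(3,2)] regime_bounds[OF assms(1-4) reg] by auto
  have S: "D \<le> sqrt (D\<^sup>2 + 4 * B_q L \<theta> * gamma_dir L \<theta> n)"
    using g B_q_pos[OF assms(3,2)] by (intro real_le_rsqrt) simp
  have "lambda_PL \<mu> L \<theta> n \<le> 2 * gamma_dir L \<theta> n / (D + D)"
    unfolding lambda_PL_def D_def[symmetric] using D S g by (intro divide_left_mono) auto
  also have "\<dots> = gamma_dir L \<theta> n / D" by simp
  also have "\<dots> \<le> gamma_dir L \<theta> n / (1 / 2304)" using D g by (intro divide_left_mono) auto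
  also have "\<dots> \<le> 2304 * 99 * \<theta> ^ 3 / L" using g by simp
  finally show ?thesis .
qed

lemma stationary_term_bound:
  assumes "0 < \<mu>" "0 < L" "0 < \<theta>" "0 \<le> v2" "0 < n" "0 < H" "0 < b"
    and adm: "PL_admissible \<mu> L \<theta> n" and reg: "PL_regime \<mu> L \<theta>"
  shows "(delta_dir L \<theta> n H b v2 + lambda_PL \<mu> L \<theta> n * A_q H b v2) / rho_PL \<mu> L \<theta> n
    \<le> 12000000 * (\<theta> * v2 / (\<mu> * real n * real H * real b) + \<theta>\<^sup>2 * v2 / (\<mu> * real H * real b))"
proof -
  define N where "N = v2 / (real H * real b)"
  have N: "0 \<le> N" using assms by (simp add: N_def)
  define E where "E = \<theta> / real n + \<theta>\<^sup>2"
  have rho: "\<mu> * \<theta> / (8 * L) \<le> rho_PL \<mu> L \<theta> n"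
    using rho_PL_regime_ge[OF assms(1-3,5) adm reg] .
  have num: "delta_dir L \<theta> n H b v2 + lambda_PL \<mu> L \<theta> n * A_q H b v2
      \<le> 1400000 * \<theta> * E * N / L"
  proof -
    have d: "delta_dir L \<theta> n H b v2 = 16 * (\<theta> * E * N / L)"
      by (simp add: delta_dir_def N_def E_def field_simps power3_eq_cube power2_eq_square)
    have "A_q H b v2 = 6 * N" by (simp add: A_q_def N_def)
    then have "lambda_PL \<mu> L \<theta> n * A_q H b v2 \<le> (2304 * 99 * \<theta> ^ 3 / L) * (6 * N)"
      using mult_right_mono[OF lambda_PL_regime_le[OF assms(1-3,5) adm reg], of "6 * N"] N by simp
    also have "\<dots> = 1368576 * (\<theta> * \<theta>\<^sup>2 * N / L)"
      by (simp add: power3_eq_cube power2_eq_square)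
    also have "\<dots> \<le> 1368576 * (\<theta> * E * N / L)" using assms N
      by (intro mult_left_mono divide_right_mono mult_right_mono) (auto simp: E_def)
    finally have l: "lambda_PL \<mu> L \<theta> n * A_q H b v2 \<le> 1368576 * (\<theta> * E * N / L)" .
    have "0 \<le> \<theta> * E * N / L" using assms N by (simp add: E_def)
    then have "delta_dir L \<theta> n H b v2 + lambda_PL \<mu> L \<theta> n * A_q H b v2
        \<le> 16 * (\<theta> * E * N / L) + 1368576 * (\<theta> * E * N / L)"
      using d l by (intro add_mono) simp_all
    also have "\<dots> = 1368592 * (\<theta> * E * N / L)" by (simp only: distrib_right[symmetric]) simp
    also have "\<dots> \<le> 1400000 * (\<theta> * E * N / L)"
      using \<open>0 \<le> \<theta> * E * N / L\<close> by (rule mult_right_mono[rotated]) simp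
    finally have "delta_dir L \<theta> n H b v2 + lambda_PL \<mu> L \<theta> n * A_q H b v2
        \<le> 1400000 * (\<theta> * E * N / L)" .
    then show ?thesis by simp
  qed
  have E0: "0 \<le> E" using assms by (simp add: E_def)
  have "(delta_dir L \<theta> n H b v2 + lambda_PL \<mu> L \<theta> n * A_q H b v2) / rho_PL \<mu> L \<theta> n
      \<le> (1400000 * \<theta> * E * N / L) / rho_PL \<mu> L \<theta> n"
    using num rho_PL_pos[OF assms(2,3) adm] by (intro divide_right_mono) auto
  also have "\<dots> \<le> (1400000 * \<theta> * E * N / L) / (\<mu> * \<theta> / (8 * L))"
    using rho assms N E0 rho_PL_pos[OF assms(2,3) adm]
    by (intro divide_left_mono) (auto intro!: mult_pos_pos divide_pos_pos)
  \<comment> \<open>The constant is \<open>8 * 1400000\<close>, rounded up.\<close>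
  also have "\<dots> = 11200000 * (E * N / \<mu>)" using assms by (simp add: field_simps)
  also have "\<dots> \<le> 12000000 * (E * N / \<mu>)"
    using N E0 assms by (intro mult_right_mono) auto
  also have "E * N / \<mu> = \<theta> * v2 / (\<mu> * real n * real H * real b) + \<theta>\<^sup>2 * v2 / (\<mu> * real H * real b)"
    using assms by (simp add: E_def N_def field_simps)
  finally show ?thesis .
qed

section \<open>Gradients of smooth functions\<close>

lemma grad_eqI:
  fixes f :: "real ^ 'd \<Rightarrow> real"
  assumes "GDERIV f x :> D"
  shows "grad f x = D"
  unfolding grad_def
proof (rule the_equality)
  fix D' assume "GDERIV f x :> D'"
  then have "(\<lambda>h. inner h D') = (\<lambda>h. inner h D)"
    using assms has_derivative_unique unfolding gderiv_def by blast
  then have "inner (D' - D) D' = inner (D' - D) D" by metis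
  then have "inner (D' - D) (D' - D) = 0" by (simp add: inner_diff_right)
  then show "D' = D" by simp
qed (fact assms)

lemma GDERIV_grad:
  fixes f :: "real ^ 'd \<Rightarrow> real"
  assumes "f differentiable (at x)"
  shows "GDERIV f x :> grad f x"
proof -
  obtain f' where f': "(f has_derivative f') (at x)" using assms by (auto simp: differentiable_def)
  have "f' = (\<lambda>h. inner h (adjoint f' 1))"
    using adjoint_works[OF has_derivative_linear[OF f'], of _ 1] by (simp add: fun_eq_iff)
  with f' have der: "GDERIV f x :> adjoint f' 1" by (simp add: gderiv_def)
  then show ?thesis by (simp only: grad_eqI[OF der])
qed

lemma L_smooth_GDERIV: "L_smooth L f \<Longrightarrow> GDERIV f x :> grad f x"
  by (simp add: L_smooth_def GDERIV_grad)

lemma L_smooth_lipschitz: "L_smooth L f \<Longrightarrow> norm (grad f x - grad f y) \<le> L * norm (x - y)"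
  unfolding L_smooth_def using lipschitz_onD[of L UNIV "grad f" x y] by (simp add: dist_norm)

lemma L_smooth_continuous_grad: "L_smooth L f \<Longrightarrow> continuous_on UNIV (grad f)"
  unfolding L_smooth_def using lipschitz_on_continuous_on by blast

lemma L_smooth_continuous: "L_smooth L f \<Longrightarrow> continuous_on UNIV f"
  unfolding L_smooth_def
  by (auto intro!: continuous_at_imp_continuous_on differentiable_imp_continuous_within)

lemma L_smooth_average:
  fixes f :: "nat \<Rightarrow> real ^ 'd \<Rightarrow> real"
  assumes k: "0 < k" and f: "\<And>j. j < k \<Longrightarrow> L_smooth L (f j)"
  shows "L_smooth L (\<lambda>x. (1 / real k) * (\<Sum>j<k. f j x))" (is "L_smooth L ?A")
    and "grad (\<lambda>x. (1 / real k) * (\<Sum>j<k. f j x)) x = (1 / real k) *\<^sub>R (\<Sum>j<k. grad (f j) x)"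
proof -
  have der: "GDERIV ?A x :> (1 / real k) *\<^sub>R (\<Sum>j<k. grad (f j) x)" for x
  proof -
    have "(f j has_derivative (\<lambda>h. inner h (grad (f j) x))) (at x)" if "j < k" for j
      using L_smooth_GDERIV[OF f[OF that]] by (simp add: gderiv_def)
    then have "(?A has_derivative (\<lambda>h. (1 / real k) * (\<Sum>j<k. inner h (grad (f j) x)))) (at x)"
      by (intro has_derivative_mult_right has_derivative_sum) auto
    then show ?thesis by (simp add: gderiv_def inner_sum_right)
  qed
  show gr: "grad ?A x = (1 / real k) *\<^sub>R (\<Sum>j<k. grad (f j) x)" for x
    using grad_eqI[OF der] .
  have L: "0 \<le> L" using f[OF k] lipschitz_on_nonneg by (auto simp: L_smooth_def)
  show "L_smooth L ?A"
    unfolding L_smooth_def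
  proof (intro conjI allI lipschitz_onI L)
    show "?A differentiable (at x)" for x
      using der[of x] unfolding gderiv_def differentiable_def by blast
    fix x y
    have "dist (grad ?A x) (grad ?A y)
        = norm ((1 / real k) *\<^sub>R (\<Sum>j<k. grad (f j) x - grad (f j) y))"
      unfolding gr dist_norm by (simp only: sum_subtractf scaleR_diff_right)
    also have "\<dots> \<le> (1 / real k) * (\<Sum>j<k. norm (grad (f j) x - grad (f j) y))"
      using norm_sum[of "\<lambda>j. grad (f j) x - grad (f j) y" "{..<k}"] by (simp add: divide_right_mono)
    also have "\<dots> \<le> (1 / real k) * (\<Sum>j<k. L * norm (x - y))"
      by (intro mult_left_mono sum_mono L_smooth_lipschitz f) auto
    also have "\<dots> = L * dist x y" using k by (simp add: dist_norm)
    finally show "dist (grad ?A x) (grad ?A y) \<le> L * dist x y" .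
  qed
qed

lemma descent_lemma:
  fixes f :: "real ^ 'd \<Rightarrow> real"
  assumes f: "L_smooth L f"
  shows "f (x + d) \<le> f x + inner (grad f x) d + L / 2 * (norm d)\<^sup>2"
proof -
  define h where "h s = f (x + s *\<^sub>R d) - s * inner (grad f x) d - L / 2 * s\<^sup>2 * (norm d)\<^sup>2" for s
  have "h 1 \<le> h 0"
  proof (rule DERIV_nonpos_imp_nonincreasing[of 0 1 h])
    fix s :: real assume s: "0 \<le> s" "s \<le> 1"
    let ?D = "inner d (grad f (x + s *\<^sub>R d)) - inner (grad f x) d - L * s * (norm d)\<^sup>2"
    have "(f has_derivative (\<lambda>h. inner h (grad f (x + s *\<^sub>R d)))) (at (x + s *\<^sub>R d))"
      using L_smooth_GDERIV[OF f] by (simp add: gderiv_def)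
    moreover have "((\<lambda>s. x + s *\<^sub>R d) has_derivative (\<lambda>u. u *\<^sub>R d)) (at s)"
      by (auto intro!: derivative_eq_intros)
    ultimately have "((\<lambda>s. f (x + s *\<^sub>R d)) has_derivative
        (\<lambda>u. inner (u *\<^sub>R d) (grad f (x + s *\<^sub>R d)))) (at s)"
      using has_derivative_compose by blast
    then have "((\<lambda>s. f (x + s *\<^sub>R d)) has_real_derivative inner d (grad f (x + s *\<^sub>R d))) (at s)"
      by (simp add: has_field_derivative_def mult.commute[of _ "inner d _"])
    then have "(h has_real_derivative ?D) (at s)"
      unfolding h_def by (auto intro!: derivative_eq_intros)
    moreover have "?D \<le> 0"
    proof -
      have "inner d (grad f (x + s *\<^sub>R d)) - inner (grad f x) d
          = inner (grad f (x + s *\<^sub>R d) - grad f x) d"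
        by (simp add: inner_diff_left inner_diff_right inner_commute)
      also have "\<dots> \<le> norm (grad f (x + s *\<^sub>R d) - grad f x) * norm d"
        by (rule norm_cauchy_schwarz)
      also have "\<dots> \<le> (L * norm ((x + s *\<^sub>R d) - x)) * norm d"
        by (intro mult_right_mono L_smooth_lipschitz[OF f]) simp
      also have "\<dots> = L * s * (norm d)\<^sup>2" using s by (simp add: power2_eq_square)
      finally show ?thesis by simp
    qed
    ultimately show "\<exists>D. (h has_real_derivative D) (at s) \<and> D \<le> 0" by blast
  qed simp
  then show ?thesis by (simp add: h_def)
qed

lemma grad_norm_le_gap:
  fixes f :: "real ^ 'd \<Rightarrow> real"
  assumes f: "L_smooth L f" and L: "0 < L" and min: "\<And>z. f xs \<le> f z"
  shows "(norm (grad f x))\<^sup>2 \<le> 2 * L * (f x - f xs)"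
proof -
  \<comment> \<open>The gradient step of length \<open>1 / L\<close> minimises the quadratic upper model.\<close>
  let ?d = "- (1 / L) *\<^sub>R grad f x"
  have "f xs \<le> f x + inner (grad f x) ?d + L / 2 * (norm ?d)\<^sup>2"
    using min[of "x + ?d"] descent_lemma[OF f, of x ?d] by linarith
  also have "\<dots> = f x - (norm (grad f x))\<^sup>2 / (2 * L)"
    using L by (simp add: power2_norm_eq_inner[symmetric] power_mult_distrib power_divide field_simps
        power2_eq_square)
  finally show ?thesis using L by (simp add: field_simps)
qed

lemma norm_sum_sq_le:
  fixes v :: "'i \<Rightarrow> 'a :: real_inner"
  assumes "finite I"
  shows "(norm (\<Sum>i\<in>I. v i))\<^sup>2 \<le> real (card I) * (\<Sum>i\<in>I. (norm (v i))\<^sup>2)"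
proof -
  have "(norm (\<Sum>i\<in>I. v i))\<^sup>2 \<le> (\<Sum>i\<in>I. norm (v i))\<^sup>2"
    by (intro power_mono norm_sum) simp
  also have "\<dots> \<le> (\<Sum>i\<in>I. (1::real)\<^sup>2) * (\<Sum>i\<in>I. (norm (v i))\<^sup>2)"
    using Cauchy_Schwarz_ineq_sum[of "\<lambda>_. 1" "\<lambda>i. norm (v i)" I] by simp
  finally show ?thesis by simp
qed

lemma norm_average_sq_le:
  fixes v :: "nat \<Rightarrow> 'a :: real_inner"
  assumes "0 < k"
  shows "(norm ((1 / real k) *\<^sub>R (\<Sum>i<k. v i)))\<^sup>2 \<le> (1 / real k) * (\<Sum>i<k. (norm (v i))\<^sup>2)"
proof -
  have "(norm ((1 / real k) *\<^sub>R (\<Sum>i<k. v i)))\<^sup>2 = (1 / real k)\<^sup>2 * (norm (\<Sum>i<k. v i))\<^sup>2"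
    by (simp add: power_mult_distrib power_divide)
  also have "\<dots> \<le> (1 / real k)\<^sup>2 * (real k * (\<Sum>i<k. (norm (v i))\<^sup>2))"
    using norm_sum_sq_le[of "{..<k}" v] by (intro mult_left_mono) auto
  also have "\<dots> = (1 / real k) * (\<Sum>i<k. (norm (v i))\<^sup>2)"
    using assms by (simp add: power2_eq_square)
  finally show ?thesis .
qed

lemma norm_add_sq_le:
  fixes u v :: "'a :: real_inner"
  shows "(norm (u + v))\<^sup>2 \<le> 2 * (norm u)\<^sup>2 + 2 * (norm v)\<^sup>2"
proof -
  have "(norm (u + v))\<^sup>2 + (norm (u - v))\<^sup>2 = 2 * (norm u)\<^sup>2 + 2 * (norm v)\<^sup>2"
    by (simp add: power2_norm_eq_inner algebra_simps)
  then show ?thesis using zero_le_power2[of "norm (u - v)"] by linarith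
qed

lemma norm_add3_sq_le:
  fixes u v w :: "'a :: real_inner"
  shows "(norm (u + v + w))\<^sup>2 \<le> 3 * ((norm u)\<^sup>2 + (norm v)\<^sup>2 + (norm w)\<^sup>2)"
  using norm_sum_sq_le[of "{..<3::nat}" "\<lambda>i. [u, v, w] ! i"]
  by (simp add: numeral_3_eq_3 lessThan_Suc algebra_simps)

lemma norm_add4_sq_le:
  fixes u v w z :: "'a :: real_inner"
  shows "(norm (u + v + w + z))\<^sup>2 \<le> 4 * ((norm u)\<^sup>2 + (norm v)\<^sup>2 + (norm w)\<^sup>2 + (norm z)\<^sup>2)"
  using norm_add_sq_le[of "u + v" "w + z"] norm_add_sq_le[of u v] norm_add_sq_le[of w z]
  by (simp add: add.assoc)

section \<open>Essentially bounded random vectors and conditional expectations\<close>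

text \<open>Essentially bounded measurable functions. The iterates, the gradients and the noise are of this kind,
  because the iterates stay in a ball; only the controls of round 0 need not be.\<close>

definition ess_bounded :: "'w measure \<Rightarrow> ('w \<Rightarrow> 'a :: {banach, second_countable_topology}) \<Rightarrow> bool"
  where "ess_bounded M f \<longleftrightarrow> f \<in> borel_measurable M \<and> (\<exists>C. AE w in M. norm (f w) \<le> C)"

lemma ess_boundedI: "f \<in> borel_measurable M \<Longrightarrow> AE w in M. norm (f w) \<le> C \<Longrightarrow> ess_bounded M f"
  by (auto simp: ess_bounded_def)

lemma ess_bounded_measurable: "ess_bounded M f \<Longrightarrow> f \<in> borel_measurable M"
  by (simp add: ess_bounded_def)

lemma ess_bounded_const: "ess_bounded M (\<lambda>w. c)"
  by (rule ess_boundedI[where C = "norm c"]) auto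

lemma ess_bounded_add:
  assumes "ess_bounded M f" "ess_bounded M g"
  shows "ess_bounded M (\<lambda>w. f w + g w)"
proof -
  from assms obtain C D where "AE w in M. norm (f w) \<le> C" "AE w in M. norm (g w) \<le> D"
    by (auto simp: ess_bounded_def)
  then have "AE w in M. norm (f w + g w) \<le> C + D"
    by eventually_elim (rule norm_triangle_mono)
  with assms show ?thesis by (auto simp: ess_bounded_def)
qed

lemma ess_bounded_scaleR:
  assumes "ess_bounded M f"
  shows "ess_bounded M (\<lambda>w. c *\<^sub>R f w)"
proof -
  from assms obtain C where "AE w in M. norm (f w) \<le> C" by (auto simp: ess_bounded_def)
  then have "AE w in M. norm (c *\<^sub>R f w) \<le> \<bar>c\<bar> * C"
    by eventually_elim (simp add: mult_left_mono)
  with assms show ?thesis by (auto simp: ess_bounded_def)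
qed

lemma ess_bounded_diff:
  "ess_bounded M f \<Longrightarrow> ess_bounded M g \<Longrightarrow> ess_bounded M (\<lambda>w. f w - g w)"
  using ess_bounded_add[OF _ ess_bounded_scaleR[of M g "-1"], of f] by simp

lemma ess_bounded_sum:
  "(\<And>i. i \<in> I \<Longrightarrow> ess_bounded M (f i)) \<Longrightarrow> ess_bounded M (\<lambda>w. \<Sum>i\<in>I. f i w)"
  by (induction I rule: infinite_finite_induct) (auto intro: ess_bounded_add ess_bounded_const)

lemma ess_bounded_inner:
  fixes f g :: "'w \<Rightarrow> 'a :: euclidean_space"
  assumes "ess_bounded M f" "ess_bounded M g"
  shows "ess_bounded M (\<lambda>w. inner (f w) (g w))"
proof -
  from assms obtain C D where "AE w in M. norm (f w) \<le> C" "AE w in M. norm (g w) \<le> D"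
    by (auto simp: ess_bounded_def)
  then have "AE w in M. norm (inner (f w) (g w)) \<le> C * D"
  proof eventually_elim
    case (elim w)
    have "norm (inner (f w) (g w)) \<le> norm (f w) * norm (g w)" by (simp add: Cauchy_Schwarz_ineq2)
    also have "\<dots> \<le> C * D" using elim order_trans[OF norm_ge_zero elim(1)] by (intro mult_mono) auto
    finally show ?case .
  qed
  with assms show ?thesis by (auto simp: ess_bounded_def)
qed

lemma ess_bounded_norm_sq:
  fixes f :: "'w \<Rightarrow> 'a :: euclidean_space"
  shows "ess_bounded M f \<Longrightarrow> ess_bounded M (\<lambda>w. (norm (f w))\<^sup>2)"
  using ess_bounded_inner[of M f f] by (simp add: power2_norm_eq_inner)

lemma ess_bounded_component:
  fixes f :: "'w \<Rightarrow> real ^ 'd"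
  shows "ess_bounded M f \<Longrightarrow> ess_bounded M (\<lambda>w. f w $ k)"
  using ess_bounded_inner[OF _ ess_bounded_const, of M f "axis k 1"] by (simp add: inner_axis)

lemma (in finite_measure) ess_bounded_integrable: "ess_bounded M f \<Longrightarrow> integrable M f"
  using integrable_const_bound by (auto simp: ess_bounded_def)

lemma (in finite_measure) integral_norm_sum_orthogonal:
  fixes X :: "'i \<Rightarrow> 'a \<Rightarrow> 'b :: euclidean_space"
  assumes "finite I" and X: "\<And>i. i \<in> I \<Longrightarrow> ess_bounded M (X i)"
    and orth: "\<And>i j. i \<in> I \<Longrightarrow> j \<in> I \<Longrightarrow> i \<noteq> j \<Longrightarrow> (\<integral>w. inner (X i w) (X j w) \<partial>M) = 0"
  shows "(\<integral>w. (norm (\<Sum>i\<in>I. X i w))\<^sup>2 \<partial>M) = (\<Sum>i\<in>I. \<integral>w. (norm (X i w))\<^sup>2 \<partial>M)"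
proof -
  have int: "integrable M (\<lambda>w. inner (X i w) (X j w))" if "i \<in> I" "j \<in> I" for i j
    using that X by (intro ess_bounded_integrable ess_bounded_inner)
  have "(\<integral>w. (norm (\<Sum>i\<in>I. X i w))\<^sup>2 \<partial>M) = (\<integral>w. (\<Sum>i\<in>I. \<Sum>j\<in>I. inner (X i w) (X j w)) \<partial>M)"
    by (simp add: power2_norm_eq_inner inner_sum_left inner_sum_right inner_commute)
  also have "\<dots> = (\<Sum>i\<in>I. \<integral>w. (\<Sum>j\<in>I. inner (X i w) (X j w)) \<partial>M)"
    using int by (intro Bochner_Integration.integral_sum Bochner_Integration.integrable_sum)
  also have "\<dots> = (\<Sum>i\<in>I. \<Sum>j\<in>I. \<integral>w. inner (X i w) (X j w) \<partial>M)"
    using int by (intro sum.cong refl Bochner_Integration.integral_sum)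
  also have "\<dots> = (\<Sum>i\<in>I. \<Sum>j\<in>I. if i = j then \<integral>w. inner (X i w) (X i w) \<partial>M else 0)"
    using orth by (intro sum.cong refl) auto
  finally show ?thesis using \<open>finite I\<close> by (simp add: power2_norm_eq_inner)
qed

lemma (in prob_space) sigma_finite_subalgebra_of_subalgebra:
  assumes "subalgebra M G"
  shows "sigma_finite_subalgebra M G"
proof -
  interpret finite_measure_subalgebra M G by unfold_locales (rule assms)
  show ?thesis by unfold_locales
qed

lemma (in prob_space) integral_inner_vec_cond_exp:
  fixes X Y Z :: "'a \<Rightarrow> real ^ 'd"
  assumes G: "subalgebra M G" and ZG: "Z \<in> borel_measurable G"
    and bd: "ess_bounded M X" "ess_bounded M Y" "ess_bounded M Z"
    and ce: "AE w in M. vec_cond_exp M G X w = Y w"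
  shows "(\<integral>w. inner (Z w) (X w - Y w) \<partial>M) = 0"
proof -
  interpret sigma_finite_subalgebra M G by (rule sigma_finite_subalgebra_of_subalgebra[OF G])
  have comp: "(\<integral>w. Z w $ k * (X w $ k - Y w $ k) \<partial>M) = 0" for k
  proof -
    have b: "ess_bounded M (\<lambda>w. X w $ k)" "ess_bounded M (\<lambda>w. Y w $ k)" "ess_bounded M (\<lambda>w. Z w $ k)"
      using bd by (auto intro: ess_bounded_component)
    have m: "(\<lambda>w. Z w $ k) \<in> borel_measurable G"
      using borel_measurable_inner[OF ZG, of "\<lambda>_. axis k 1"] by (simp add: inner_axis)
    have i: "integrable M (\<lambda>w. Z w $ k * X w $ k)" "integrable M (\<lambda>w. Z w $ k * Y w $ k)"
      using ess_bounded_integrable[OF ess_bounded_inner[OF b(3) b(1)]]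
        ess_bounded_integrable[OF ess_bounded_inner[OF b(3) b(2)]] by simp_all
    have "(\<integral>w. Z w $ k * X w $ k \<partial>M) = (\<integral>w. Z w $ k * real_cond_exp M G (\<lambda>w. X w $ k) w \<partial>M)"
      using real_cond_exp_intg(2)[OF i(1) m ess_bounded_measurable[OF b(1)]] by simp
    also have "\<dots> = (\<integral>w. Z w $ k * Y w $ k \<partial>M)"
    proof (rule integral_cong_AE)
      show "AE w in M. Z w $ k * real_cond_exp M G (\<lambda>w. X w $ k) w = Z w $ k * Y w $ k"
        using ce by eventually_elim (metis vec_cond_exp_def vec_lambda_beta)
      show "(\<lambda>w. Z w $ k * real_cond_exp M G (\<lambda>w. X w $ k) w) \<in> borel_measurable M"
        using ess_bounded_measurable[OF b(3)] by measurable
      show "(\<lambda>w. Z w $ k * Y w $ k) \<in> borel_measurable M" using i(2) by simp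
    qed
    finally show ?thesis using i by (simp add: right_diff_distrib)
  qed
  have "(\<integral>w. inner (Z w) (X w - Y w) \<partial>M) = (\<integral>w. (\<Sum>k\<in>UNIV. Z w $ k * (X w $ k - Y w $ k)) \<partial>M)"
    by (simp add: inner_vec_def)
  also have "\<dots> = (\<Sum>k\<in>UNIV. \<integral>w. Z w $ k * (X w $ k - Y w $ k) \<partial>M)"
  proof (intro Bochner_Integration.integral_sum)
    fix k
    have "ess_bounded M (\<lambda>w. inner (Z w $ k) (X w $ k - Y w $ k))"
      using bd by (intro ess_bounded_inner ess_bounded_diff ess_bounded_component)
    then show "integrable M (\<lambda>w. Z w $ k * (X w $ k - Y w $ k))"
      using ess_bounded_integrable by simp
  qed
  finally show ?thesis by (simp add: comp)
qed

lemma cond_indep_discrete_disjoint: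
  assumes ind: "cond_indep_discrete M K X I"
    and J: "J1 \<subseteq> I" "J2 \<subseteq> I" "finite J1" "finite J2" "J1 \<inter> J2 = {}"
  shows "AE w in M. real_cond_exp M K
      (\<lambda>w. (\<Prod>k\<in>J1. indicator (A k) (X k w)) * (\<Prod>k\<in>J2. indicator (A k) (X k w))) w
    = real_cond_exp M K (\<lambda>w. \<Prod>k\<in>J1. indicator (A k) (X k w)) w *
      real_cond_exp M K (\<lambda>w. \<Prod>k\<in>J2. indicator (A k) (X k w)) w"
proof -
  have "AE w in M. real_cond_exp M K (\<lambda>w. \<Prod>k\<in>J. indicator (A k) (X k w)) w =
      (\<Prod>k\<in>J. real_cond_exp M K (\<lambda>w. indicator (A k) (X k w)) w)" if "J \<subseteq> I" "finite J" for J
    using ind that by (auto simp: cond_indep_discrete_def)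
  from this[of J1] this[of J2] this[of "J1 \<union> J2"] J show ?thesis
    by (auto simp: prod.union_disjoint elim!: eventually_rev_mp)
qed

text \<open>Two quantities, each of them a \<open>K\<close>-measurable random function evaluated at a finitely valued
  random variable, are uncorrelated if these variables are conditionally independent given \<open>K\<close> and
  one of the two quantities is conditionally centred. The values \<open>f a\<close> are bounded only on the event
  that \<open>U = a\<close>.\<close>

lemma (in prob_space) cond_indep_uncorrelated:
  fixes f :: "'u \<Rightarrow> 'a \<Rightarrow> real" and h :: "'v \<Rightarrow> 'a \<Rightarrow> real"
  assumes K: "subalgebra M K"
    and fin: "finite SU" "finite SV"
    and U: "\<And>w. w \<in> space M \<Longrightarrow> U w \<in> SU" and V: "\<And>w. w \<in> space M \<Longrightarrow> V w \<in> SV"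
    and Um: "\<And>a. a \<in> SU \<Longrightarrow> (\<lambda>w. indicator {a} (U w) :: real) \<in> borel_measurable M"
    and Vm: "\<And>b. b \<in> SV \<Longrightarrow> (\<lambda>w. indicator {b} (V w) :: real) \<in> borel_measurable M"
    and f: "\<And>a. a \<in> SU \<Longrightarrow> f a \<in> borel_measurable K"
    and h: "\<And>b. b \<in> SV \<Longrightarrow> h b \<in> borel_measurable K"
    and indep: "\<And>a b. a \<in> SU \<Longrightarrow> b \<in> SV \<Longrightarrow>
       AE w in M. real_cond_exp M K (\<lambda>w. indicator {a} (U w) * indicator {b} (V w)) w =
         real_cond_exp M K (\<lambda>w. indicator {a} (U w)) w * real_cond_exp M K (\<lambda>w. indicator {b} (V w)) w"
    and bd: "ess_bounded M (\<lambda>w. f (U w) w)" "ess_bounded M (\<lambda>w. h (V w) w)"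
    and centred: "AE w in M. real_cond_exp M K (\<lambda>w. f (U w) w) w = 0"
  shows "(\<integral>w. f (U w) w * h (V w) w \<partial>M) = 0"
proof -
  interpret sigma_finite_subalgebra M K by (rule sigma_finite_subalgebra_of_subalgebra[OF K])
  define A where "A a w = (if a \<in> SU then f a w * indicator {a} (U w) else 0)" for a w
  define B where "B b w = (if b \<in> SV then h b w * indicator {b} (V w) else 0)" for b w
  have Am: "A a \<in> borel_measurable M" for a
    unfolding A_def using Um measurable_from_subalg[OF K f] by (cases "a \<in> SU") auto
  have Bm: "B b \<in> borel_measurable M" for b
    unfolding B_def using Vm measurable_from_subalg[OF K h] by (cases "b \<in> SV") auto
  obtain C D where C: "AE w in M. norm (f (U w) w) \<le> C" and D: "AE w in M. norm (h (V w) w) \<le> D"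
    using bd by (auto simp: ess_bounded_def)
  have Ab: "ess_bounded M (A a)" for a
    by (rule ess_boundedI[OF Am, where C = "max C 0"])
      (use C in \<open>eventually_elim, auto simp: A_def indicator_def\<close>)
  have Bb: "ess_bounded M (B b)" for b
    by (rule ess_boundedI[OF Bm, where C = "max D 0"])
      (use D in \<open>eventually_elim, auto simp: B_def indicator_def\<close>)
  have ABi: "integrable M (\<lambda>w. A a w * B b w)" for a b
    using ess_bounded_integrable[OF ess_bounded_inner[OF Ab Bb]] by simp
  have fA: "f (U w) w = (\<Sum>a\<in>SU. A a w)" if "w \<in> space M" for w
  proof -
    have "(\<Sum>a\<in>SU. A a w) = (\<Sum>a\<in>SU. if a = U w then f (U w) w else 0)"
      by (intro sum.cong) (auto simp: A_def indicator_def)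
    then show ?thesis using fin(1) U[OF that] by simp
  qed
  have hB: "h (V w) w = (\<Sum>b\<in>SV. B b w)" if "w \<in> space M" for w
  proof -
    have "(\<Sum>b\<in>SV. B b w) = (\<Sum>b\<in>SV. if b = V w then h (V w) w else 0)"
      by (intro sum.cong) (auto simp: B_def indicator_def)
    then show ?thesis using fin(2) V[OF that] by simp
  qed
  have sum0: "AE w in M. (\<Sum>a\<in>SU. real_cond_exp M K (A a) w) = 0"
  proof -
    have "AE w in M. real_cond_exp M K (\<lambda>w. \<Sum>a\<in>SU. A a w) w = (\<Sum>a\<in>SU. real_cond_exp M K (A a) w)"
      by (intro real_cond_exp_sum ess_bounded_integrable Ab)
    moreover have "AE w in M. real_cond_exp M K (\<lambda>w. \<Sum>a\<in>SU. A a w) w = real_cond_exp M K (\<lambda>w. f (U w) w) w"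
      using fA bd(1) Am by (intro real_cond_exp_cong AE_I2) (auto simp: ess_bounded_def)
    ultimately show ?thesis using centred by eventually_elim simp
  qed
  have prod: "AE w in M. real_cond_exp M K (\<lambda>w. A a w * B b w) w
      = real_cond_exp M K (A a) w * real_cond_exp M K (B b) w" if a: "a \<in> SU" and b: "b \<in> SV" for a b
  proof -
    let ?u = "\<lambda>w. indicator {a} (U w) :: real" and ?v = "\<lambda>w. indicator {b} (V w) :: real"
    have AB: "(\<lambda>w. A a w * B b w) = (\<lambda>w. (f a w * h b w) * (?u w * ?v w))"
      using a b by (auto simp: A_def B_def fun_eq_iff)
    have "AE w in M. real_cond_exp M K (\<lambda>w. (f a w * h b w) * (?u w * ?v w)) w
        = (f a w * h b w) * real_cond_exp M K (\<lambda>w. ?u w * ?v w) w"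
      using ABi[of a b] f[OF a] h[OF b] Um[OF a] Vm[OF b] unfolding AB
      by (intro real_cond_exp_mult) auto
    moreover have "AE w in M. real_cond_exp M K (A a) w = f a w * real_cond_exp M K ?u w"
    proof -
      have Aeq: "A a = (\<lambda>w. f a w * ?u w)" using a by (simp add: A_def fun_eq_iff)
      show ?thesis unfolding Aeq using f[OF a] Um[OF a] ess_bounded_integrable[OF Ab[of a]] unfolding Aeq
        by (intro real_cond_exp_mult) auto
    qed
    moreover have "AE w in M. real_cond_exp M K (B b) w = h b w * real_cond_exp M K ?v w"
    proof -
      have Beq: "B b = (\<lambda>w. h b w * ?v w)" using b by (simp add: B_def fun_eq_iff)
      show ?thesis unfolding Beq using h[OF b] Vm[OF b] ess_bounded_integrable[OF Bb[of b]] unfolding Beq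
        by (intro real_cond_exp_mult) auto
    qed
    ultimately show ?thesis unfolding AB using indep[OF a b] by eventually_elim simp
  qed
  have cABi: "integrable M (\<lambda>w. real_cond_exp M K (A a) w * real_cond_exp M K (B b) w)"
    and cAB: "(\<integral>w. A a w * B b w \<partial>M) = (\<integral>w. real_cond_exp M K (A a) w * real_cond_exp M K (B b) w \<partial>M)"
    if a: "a \<in> SU" and b: "b \<in> SV" for a b
  proof -
    note i = real_cond_exp_int[OF ABi[of a b]]
    have m: "(\<lambda>w. real_cond_exp M K (A a) w * real_cond_exp M K (B b) w) \<in> borel_measurable M" by simp
    show "integrable M (\<lambda>w. real_cond_exp M K (A a) w * real_cond_exp M K (B b) w)"
      using integrable_cong_AE_imp[OF i(1) m] prod[OF a b] by auto
    show "(\<integral>w. A a w * B b w \<partial>M) = (\<integral>w. real_cond_exp M K (A a) w * real_cond_exp M K (B b) w \<partial>M)"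
      unfolding i(2)[symmetric] using prod[OF a b] m by (intro integral_cong_AE) auto
  qed
  have "(\<integral>w. f (U w) w * h (V w) w \<partial>M) = (\<integral>w. (\<Sum>a\<in>SU. \<Sum>b\<in>SV. A a w * B b w) \<partial>M)"
    by (intro Bochner_Integration.integral_cong refl) (simp add: fA hB sum_product)
  also have "\<dots> = (\<Sum>a\<in>SU. \<integral>w. (\<Sum>b\<in>SV. A a w * B b w) \<partial>M)"
    by (intro Bochner_Integration.integral_sum Bochner_Integration.integrable_sum ABi)
  also have "\<dots> = (\<Sum>a\<in>SU. \<Sum>b\<in>SV. \<integral>w. A a w * B b w \<partial>M)"
    by (intro sum.cong refl Bochner_Integration.integral_sum ABi)
  also have "\<dots> = (\<Sum>a\<in>SU. \<Sum>b\<in>SV. \<integral>w. real_cond_exp M K (A a) w * real_cond_exp M K (B b) w \<partial>M)"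
    by (intro sum.cong refl cAB)
  also have "\<dots> = (\<Sum>a\<in>SU. \<integral>w. (\<Sum>b\<in>SV. real_cond_exp M K (A a) w * real_cond_exp M K (B b) w) \<partial>M)"
    by (intro sum.cong refl Bochner_Integration.integral_sum[symmetric] cABi)
  also have "\<dots> = (\<integral>w. (\<Sum>a\<in>SU. \<Sum>b\<in>SV. real_cond_exp M K (A a) w * real_cond_exp M K (B b) w) \<partial>M)"
    by (intro Bochner_Integration.integral_sum[symmetric] Bochner_Integration.integrable_sum cABi)
  also have "\<dots> = (\<integral>w. 0 \<partial>M)"
  proof (rule integral_cong_AE)
    show "AE w in M. (\<Sum>a\<in>SU. \<Sum>b\<in>SV. real_cond_exp M K (A a) w * real_cond_exp M K (B b) w) = 0"
      using sum0 by eventually_elim (simp add: sum_product[symmetric])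
  qed auto
  finally show ?thesis by simp
qed

section \<open>The algorithm and its filtration\<close>

text \<open>A run of the uniform-controller algorithm under the standing assumptions. The local step size is
  \<open>\<theta> / (L H)\<close>, named \<open>\<eta>\<close> below.\<close>

locale controller_run = prob_space M
  for M :: "'w measure" +
  fixes n H b :: nat and m :: "nat \<Rightarrow> nat"
    and \<phi> :: "nat \<Rightarrow> nat \<Rightarrow> real ^ 'd \<Rightarrow> real"
    and L R \<theta> :: real and xstar :: "real ^ 'd"
    and Bat :: "nat \<Rightarrow> nat \<Rightarrow> nat \<Rightarrow> 'w \<Rightarrow> nat set"
    and x :: "nat \<Rightarrow> 'w \<Rightarrow> real ^ 'd"
    and y :: "nat \<Rightarrow> nat \<Rightarrow> nat \<Rightarrow> 'w \<Rightarrow> real ^ 'd"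
    and c :: "nat \<Rightarrow> nat \<Rightarrow> 'w \<Rightarrow> real ^ 'd"
    and cbar :: "nat \<Rightarrow> 'w \<Rightarrow> real ^ 'd"
  assumes sizes: "0 < n" "0 < H" "0 < b" "\<And>i. i < n \<Longrightarrow> 0 < m i"
    and L_pos: "0 < L"
    and amplitude: "0 < \<theta>" "288 * \<theta>\<^sup>2 < 1"
    and smooth: "\<And>i j. i < n \<Longrightarrow> j < m i \<Longrightarrow> L_smooth L (\<phi> i j)"
    and minimizer: "\<And>z. global_obj n m \<phi> xstar \<le> global_obj n m \<phi> z"
    and init_measurable: "x 0 \<in> borel_measurable M" "\<And>i. i < n \<Longrightarrow> c i 0 \<in> borel_measurable M"
    and batch_measurable: "\<And>i t l. i < n \<Longrightarrow> l < H \<Longrightarrow> Bat i t l \<in> M \<rightarrow>\<^sub>M count_space UNIV"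
    and batch_subset: "\<And>i t l w. i < n \<Longrightarrow> l < H \<Longrightarrow> w \<in> space M \<Longrightarrow> Bat i t l w \<subseteq> {..<m i}"
    and cbar_0: "\<And>w. w \<in> space M \<Longrightarrow> cbar 0 w = (1 / real n) *\<^sub>R (\<Sum>i<n. c i 0 w)"
    and y_0: "\<And>i t w. i < n \<Longrightarrow> w \<in> space M \<Longrightarrow> y i t 0 w = x t w"
    and y_Suc: "\<And>i t l w. i < n \<Longrightarrow> l < H \<Longrightarrow> w \<in> space M \<Longrightarrow>
        y i t (Suc l) w = y i t l w - (\<theta> / (L * real H)) *\<^sub>R
          ((1 / real b) *\<^sub>R (\<Sum>j\<in>Bat i t l w. grad (\<phi> i j) (y i t l w)) - c i t w + cbar t w)"
    and c_Suc: "\<And>i t w. i < n \<Longrightarrow> w \<in> space M \<Longrightarrow>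
        c i (Suc t) w = c i t w - cbar t w +
          (1 / (real H * (\<theta> / (L * real H)))) *\<^sub>R (x t w - y i t H w)"
    and x_Suc: "\<And>t w. w \<in> space M \<Longrightarrow>
        x (Suc t) w = x t w + (1 / real n) *\<^sub>R (\<Sum>i<n. y i t H w - x t w)"
    and cbar_Suc: "\<And>t w. w \<in> space M \<Longrightarrow>
        cbar (Suc t) w = cbar t w + (1 / real n) *\<^sub>R (\<Sum>i<n. c i (Suc t) w - c i t w)"
    and in_ball: "AE w in M. \<forall>t. x t w \<in> cball xstar R \<and>
        (\<forall>i<n. \<forall>l\<le>H. y i t l w \<in> cball xstar R)"
    and batch_indep: "\<And>i t l. i < n \<Longrightarrow> l < H \<Longrightarrow>
        cond_indep_discrete M (step_algebra M n H (x 0) (\<lambda>i. c i 0) Bat i t l)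
          (\<lambda>(j, k). Bat j t k) ({..<n} \<times> {..<H})"
    and unbiased: "\<And>i t l. i < n \<Longrightarrow> l < H \<Longrightarrow>
        AE w in M. vec_cond_exp M (step_algebra M n H (x 0) (\<lambda>i. c i 0) Bat i t l)
            (\<lambda>w. (1 / real b) *\<^sub>R (\<Sum>j\<in>Bat i t l w. grad (\<phi> i j) (y i t l w))) w
          = grad (node_obj m \<phi> i) (y i t l w)"
    and variance: "\<And>i t l. i < n \<Longrightarrow> l < H \<Longrightarrow>
        AE w in M. real_cond_exp M (step_algebra M n H (x 0) (\<lambda>i. c i 0) Bat i t l)
            (\<lambda>w. (norm ((1 / real b) *\<^sub>R (\<Sum>j\<in>Bat i t l w. grad (\<phi> i j) (y i t l w))
                         - grad (node_obj m \<phi> i) (y i t l w)))\<^sup>2) w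
          \<le> node_var m \<phi> xstar R i / real b"
begin

abbreviation Fi :: "nat \<Rightarrow> real ^ 'd \<Rightarrow> real" where "Fi \<equiv> node_obj m \<phi>"

abbreviation F :: "real ^ 'd \<Rightarrow> real" where "F \<equiv> global_obj n m \<phi>"

abbreviation v2 :: real where "v2 \<equiv> max_var n m \<phi> xstar R"

abbreviation G :: "nat \<Rightarrow> nat \<Rightarrow> nat \<Rightarrow> 'w measure" where
  "G \<equiv> step_algebra M n H (x 0) (\<lambda>i. c i 0) Bat"

abbreviation \<F> :: "nat \<Rightarrow> 'w measure" where
  "\<F> \<equiv> round_algebra M n H (x 0) (\<lambda>i. c i 0) Bat"

definition \<eta> :: real where "\<eta> = \<theta> / (L * real H)"

text \<open>\<open>batch_grad i B z\<close> is the gradient estimate of node \<open>i\<close> at \<open>z\<close> from the batch \<open>B\<close>,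
  \<open>sgrad\<close> the estimate used by the algorithm, \<open>noise\<close> its error and \<open>err\<close> the error of the
  controls.\<close>

definition batch_grad :: "nat \<Rightarrow> nat set \<Rightarrow> real ^ 'd \<Rightarrow> real ^ 'd" where
  "batch_grad i B z = (1 / real b) *\<^sub>R (\<Sum>j\<in>B. grad (\<phi> i j) z)"

definition sgrad :: "nat \<Rightarrow> nat \<Rightarrow> nat \<Rightarrow> 'w \<Rightarrow> real ^ 'd" where
  "sgrad i t l w = batch_grad i (Bat i t l w) (y i t l w)"

definition noise :: "nat \<Rightarrow> nat \<Rightarrow> nat \<Rightarrow> 'w \<Rightarrow> real ^ 'd" where
  "noise i t l w = sgrad i t l w - grad (Fi i) (y i t l w)"

definition err :: "nat \<Rightarrow> nat \<Rightarrow> 'w \<Rightarrow> real ^ 'd" where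
  "err i t w = c i t w - grad (Fi i) (x t w)"

lemma eta_pos: "0 < \<eta>"
  using sizes L_pos amplitude by (simp add: \<eta>_def)

lemma theta_le_half: "\<theta> \<le> 1 / 2"
proof -
  have "\<theta>\<^sup>2 \<le> (1 / 2)\<^sup>2" using amplitude by (simp add: power2_eq_square)
  then show ?thesis by (rule power2_le_imp_le) simp
qed

lemma smooth_Fi: "i < n \<Longrightarrow> L_smooth L (Fi i)"
  using L_smooth_average(1)[of "m i" L "\<phi> i"] sizes smooth unfolding node_obj_def by auto

lemma smooth_F: "L_smooth L F"
  using L_smooth_average(1)[of n L Fi] sizes smooth_Fi unfolding global_obj_def by auto

lemma grad_F: "grad F z = (1 / real n) *\<^sub>R (\<Sum>i<n. grad (Fi i) z)"
  using L_smooth_average(2)[of n L Fi z] sizes smooth_Fi unfolding global_obj_def by auto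

lemma grad_measurable:
  assumes "L_smooth L f" "z \<in> borel_measurable N"
  shows "(\<lambda>w. grad f (z w)) \<in> borel_measurable N"
  using borel_measurable_continuous_onI[OF L_smooth_continuous_grad[OF assms(1)]] assms(2)
  by (rule measurable_compose[rotated])

subsection \<open>Closed forms of the updates\<close>

lemma y_Suc': "i < n \<Longrightarrow> l < H \<Longrightarrow> w \<in> space M \<Longrightarrow>
    y i t (Suc l) w = y i t l w - \<eta> *\<^sub>R (sgrad i t l w - c i t w + cbar t w)"
  using y_Suc by (simp add: \<eta>_def sgrad_def batch_grad_def)

lemma y_eq: "i < n \<Longrightarrow> l \<le> H \<Longrightarrow> w \<in> space M \<Longrightarrow>
    y i t l w = x t w - \<eta> *\<^sub>R (\<Sum>k<l. sgrad i t k w - c i t w + cbar t w)"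
proof (induction l)
  case (Suc l)
  then show ?case by (simp add: y_Suc' scaleR_add_right)
qed (simp add: y_0)

lemma cbar_eq:
  assumes "w \<in> space M"
  shows "cbar t w = (1 / real n) *\<^sub>R (\<Sum>i<n. c i t w)"
proof (induction t)
  case (Suc t)
  then show ?case using cbar_Suc[OF assms, of t] by (simp add: sum_subtractf scaleR_diff_right)
qed (simp add: cbar_0[OF assms])

lemma x_minus_y_H:
  assumes "i < n" "w \<in> space M"
  shows "x t w - y i t H w = \<eta> *\<^sub>R (\<Sum>l<H. sgrad i t l w) - (\<eta> * real H) *\<^sub>R (c i t w - cbar t w)"
  using y_eq[OF assms(1) order_refl assms(2), of t]
  by (simp add: sum.distrib sum_subtractf scaleR_add_right scaleR_diff_right sum_constant_scaleR
      del: sum_constant)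

lemma c_Suc_eq:
  assumes "i < n" "w \<in> space M"
  shows "c i (Suc t) w = (1 / real H) *\<^sub>R (\<Sum>l<H. sgrad i t l w)"
  using c_Suc[OF assms, of t] eta_pos sizes unfolding x_minus_y_H[OF assms] \<eta>_def[symmetric]
  by (simp add: scaleR_diff_right)

lemma x_Suc_eq:
  assumes w: "w \<in> space M"
  shows "x (Suc t) w = x t w - (\<theta> / L) *\<^sub>R cbar (Suc t) w"
proof -
  have eH: "\<eta> * real H = \<theta> / L" using sizes by (simp add: \<eta>_def)
  have "(\<Sum>i<n. y i t H w - x t w) = - (\<Sum>i<n. x t w - y i t H w)"
    by (simp add: sum_negf[symmetric])
  also have "(\<Sum>i<n. x t w - y i t H w)
      = (\<Sum>i<n. (\<eta> * real H) *\<^sub>R c i (Suc t) w - (\<eta> * real H) *\<^sub>R (c i t w - cbar t w))"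
    using sizes by (intro sum.cong refl) (simp add: x_minus_y_H c_Suc_eq w)
  also have "\<dots> = (\<eta> * real H) *\<^sub>R (\<Sum>i<n. c i (Suc t) w)
      - (\<eta> * real H) *\<^sub>R (\<Sum>i<n. c i t w - cbar t w)"
    by (subst sum_subtractf) (simp only: scaleR_sum_right)
  also have "(\<Sum>i<n. c i t w - cbar t w) = 0"
    using sizes by (simp add: sum_subtractf cbar_eq[OF w, of t] sum_constant_scaleR del: sum_constant)
  finally show ?thesis using x_Suc[OF w, of t] cbar_eq[OF w, of "Suc t"] eH by simp
qed

lemma err_average:
  assumes "w \<in> space M"
  shows "(1 / real n) *\<^sub>R (\<Sum>i<n. err i t w) = cbar t w - grad F (x t w)"
  using cbar_eq[OF assms] by (simp add: err_def grad_F sum_subtractf scaleR_diff_right)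

subsection \<open>Measurability\<close>

lemma batch_grad_measurable:
  assumes i: "i < n" and sp: "space N = space M"
    and B: "B \<in> N \<rightarrow>\<^sub>M count_space UNIV" "\<And>w. w \<in> space M \<Longrightarrow> B w \<subseteq> {..<m i}"
    and z: "z \<in> borel_measurable N"
  shows "(\<lambda>w. batch_grad i (B w) (z w)) \<in> borel_measurable N"
proof -
  have "(\<lambda>w. (1 / real b) *\<^sub>R (\<Sum>j<m i. (if j \<in> B w then 1 else 0) *\<^sub>R grad (\<phi> i j) (z w)))
      \<in> borel_measurable N"
  proof (intro borel_measurable_scaleR borel_measurable_sum borel_measurable_const)
    fix j assume "j \<in> {..<m i}"
    then show "(\<lambda>w. grad (\<phi> i j) (z w)) \<in> borel_measurable N"
      using smooth i z by (intro grad_measurable) auto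
    show "(\<lambda>w. if j \<in> B w then 1 else 0 :: real) \<in> borel_measurable N"
      by (rule measurable_compose[OF B(1), where g = "\<lambda>S. if j \<in> S then 1 else 0"]) simp
  qed
  moreover have "batch_grad i (B w) (z w)
      = (1 / real b) *\<^sub>R (\<Sum>j<m i. (if j \<in> B w then 1 else 0) *\<^sub>R grad (\<phi> i j) (z w))"
    if "w \<in> space N" for w
  proof -
    have "(\<Sum>j\<in>B w. grad (\<phi> i j) (z w)) = (\<Sum>j<m i. if j \<in> B w then grad (\<phi> i j) (z w) else 0)"
      using B(2) that sp by (simp add: sum.If_cases Int_absorb1)
    also have "\<dots> = (\<Sum>j<m i. (if j \<in> B w then 1 else 0) *\<^sub>R grad (\<phi> i j) (z w))"
      by (intro sum.cong) auto
    finally show ?thesis by (simp add: batch_grad_def)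
  qed
  ultimately show ?thesis by (simp cong: measurable_cong)
qed

lemma y_measurable:
  assumes i: "i < n" and sp: "space N = space M"
    and st: "x t \<in> borel_measurable N" "c i t \<in> borel_measurable N" "cbar t \<in> borel_measurable N"
  shows "l \<le> H \<Longrightarrow> (\<And>k. k < l \<Longrightarrow> Bat i t k \<in> N \<rightarrow>\<^sub>M count_space UNIV) \<Longrightarrow>
    y i t l \<in> borel_measurable N"
proof (induction l)
  case 0
  show ?case using st(1) by (subst measurable_cong[of N "y i t 0" "x t"]) (auto simp: sp y_0 i)
next
  case (Suc l)
  then have "(\<lambda>w. sgrad i t l w) \<in> borel_measurable N"
    unfolding sgrad_def using i sp batch_subset by (intro batch_grad_measurable) auto
  then have "(\<lambda>w. y i t l w - \<eta> *\<^sub>R (sgrad i t l w - c i t w + cbar t w)) \<in> borel_measurable N"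
    using Suc st by auto
  then show ?case
    by (rule measurable_cong[THEN iffD1, rotated]) (use Suc i in \<open>simp add: sp y_Suc'\<close>)
qed

lemma state_measurable:
  assumes sp: "space N = space M"
    and init: "x 0 \<in> borel_measurable N" "\<And>i. i < n \<Longrightarrow> c i 0 \<in> borel_measurable N"
    and B: "\<And>i s l. i < n \<Longrightarrow> s < t \<Longrightarrow> l < H \<Longrightarrow> Bat i s l \<in> N \<rightarrow>\<^sub>M count_space UNIV"
  shows "x t \<in> borel_measurable N" "\<And>i. i < n \<Longrightarrow> c i t \<in> borel_measurable N"
    "cbar t \<in> borel_measurable N"
proof -
  have cb: "cbar s \<in> borel_measurable N" if "\<And>i. i < n \<Longrightarrow> c i s \<in> borel_measurable N" for s
  proof -
    have "(\<lambda>w. (1 / real n) *\<^sub>R (\<Sum>i<n. c i s w)) \<in> borel_measurable N"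
      using that by (intro borel_measurable_scaleR borel_measurable_sum) auto
    then show ?thesis
      by (rule measurable_cong[THEN iffD1, rotated]) (simp add: sp cbar_eq)
  qed
  have main: "x s \<in> borel_measurable N \<and> (\<forall>i<n. c i s \<in> borel_measurable N)" if "s \<le> t" for s
    using that
  proof (induction s)
    case 0
    then show ?case using init by simp
  next
    case (Suc s)
    then have st: "x s \<in> borel_measurable N" "\<And>i. i < n \<Longrightarrow> c i s \<in> borel_measurable N" by auto
    have y: "y i s l \<in> borel_measurable N" if "i < n" "l \<le> H" for i l
      using st cb[OF st(2)] Suc.prems B that by (intro y_measurable[OF that(1) sp]) auto
    have c: "c i (Suc s) \<in> borel_measurable N" if i: "i < n" for i
    proof -
      have "(\<lambda>w. c i s w - cbar s w +
          (1 / (real H * (\<theta> / (L * real H)))) *\<^sub>R (x s w - y i s H w)) \<in> borel_measurable N"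
        using st i cb[OF st(2)] y[OF i order_refl] by auto
      then show ?thesis
        by (rule measurable_cong[THEN iffD1, rotated]) (simp add: sp c_Suc i)
    qed
    moreover have "x (Suc s) \<in> borel_measurable N"
    proof -
      have "(\<lambda>w. x s w - (\<theta> / L) *\<^sub>R cbar (Suc s) w) \<in> borel_measurable N"
        using st(1) cb[OF c] by auto
      then show ?thesis
        by (rule measurable_cong[THEN iffD1, rotated]) (simp add: sp x_Suc_eq)
    qed
    ultimately show ?case by simp
  qed
  from main[of t] show "x t \<in> borel_measurable N" "\<And>i. i < n \<Longrightarrow> c i t \<in> borel_measurable N" by auto
  then show "cbar t \<in> borel_measurable N" by (intro cb)
qed

lemma state_measurable_M:
  "x t \<in> borel_measurable M" "i < n \<Longrightarrow> c i t \<in> borel_measurable M" "cbar t \<in> borel_measurable M"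
  using state_measurable[of M t] init_measurable batch_measurable by auto

lemma y_measurable_M: "i < n \<Longrightarrow> l \<le> H \<Longrightarrow> y i t l \<in> borel_measurable M"
  using state_measurable_M batch_measurable by (intro y_measurable) auto

lemma sgrad_measurable_M: "i < n \<Longrightarrow> l < H \<Longrightarrow> sgrad i t l \<in> borel_measurable M"
  using batch_grad_measurable[of i M "Bat i t l" "y i t l"] batch_measurable batch_subset y_measurable_M
  by (simp add: sgrad_def[abs_def])

lemma space_round: "space (\<F> t) = space M"
  unfolding round_algebra_def by (intro space_measure_of) auto

lemma sets_round:
  "sets (\<F> t) = sigma_sets (space M)
     ({x 0 -` A \<inter> space M | A. A \<in> sets borel} \<union>
      {c i 0 -` A \<inter> space M | i A. i < n \<and> A \<in> sets borel} \<union>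
      {Bat i s l -` A \<inter> space M | i s l A. i < n \<and> s < t \<and> l < H})"
  unfolding round_algebra_def by (intro sets_measure_of) auto

lemma space_step: "space (G i t l) = space M"
  unfolding step_algebra_def using sets.sets_into_space[of _ "\<F> t"]
  by (intro space_measure_of) (auto simp: space_round)

lemma sets_step:
  "sets (G i t l) = sigma_sets (space M)
     (sets (\<F> t) \<union> {Bat i t k -` A \<inter> space M | k A. k < l})"
  unfolding step_algebra_def using sets.sets_into_space[of _ "\<F> t"]
  by (intro sets_measure_of) (auto simp: space_round)

lemma round_subalgebra: "subalgebra M (\<F> t)"
  unfolding subalgebra_def space_round sets_round
  using init_measurable batch_measurable
  by (auto intro!: sets.sigma_sets_subset intro: measurable_sets)

lemma step_subalgebra: "i < n \<Longrightarrow> l \<le> H \<Longrightarrow> subalgebra M (G i t l)"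
  using round_subalgebra[of t] batch_measurable unfolding subalgebra_def space_step sets_step
  by (auto intro!: sets.sigma_sets_subset intro: measurable_sets)

lemma round_subalgebra_step: "subalgebra (G i t l) (\<F> t)"
  unfolding subalgebra_def space_step space_round sets_step by auto

lemma step_subalgebra_step:
  assumes "k \<le> l"
  shows "subalgebra (G i t l) (G i t k)"
proof -
  have "{Bat i t k' -` A \<inter> space M | k' A. k' < k} \<subseteq> {Bat i t k' -` A \<inter> space M | k' A. k' < l}"
    using assms order.strict_trans2 by blast
  then show ?thesis
    unfolding subalgebra_def space_step sets_step by (intro conjI refl sigma_sets_mono') auto
qed

lemma state_measurable_round:
  "x t \<in> borel_measurable (\<F> t)" "i < n \<Longrightarrow> c i t \<in> borel_measurable (\<F> t)"
  "cbar t \<in> borel_measurable (\<F> t)"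
proof -
  have "x 0 \<in> borel_measurable (\<F> t)"
  proof (rule measurableI)
    fix A :: "(real ^ 'd) set" assume A: "A \<in> sets borel"
    show "x 0 -` A \<inter> space (\<F> t) \<in> sets (\<F> t)"
      unfolding space_round sets_round
      by (intro sigma_sets.Basic UnI1 CollectI exI[of _ A] conjI refl A)
  qed simp
  moreover have "c i 0 \<in> borel_measurable (\<F> t)" if i: "i < n" for i
  proof (rule measurableI)
    fix A :: "(real ^ 'd) set" assume A: "A \<in> sets borel"
    show "c i 0 -` A \<inter> space (\<F> t) \<in> sets (\<F> t)"
      unfolding space_round sets_round
      by (rule sigma_sets.Basic, rule UnI1, rule UnI2)
        (intro CollectI exI[of _ i] exI[of _ A] conjI refl A i)
  qed simp
  moreover have "Bat i s l \<in> \<F> t \<rightarrow>\<^sub>M count_space UNIV" if il: "i < n" "s < t" "l < H" for i s l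
  proof (rule measurableI)
    fix A
    show "Bat i s l -` A \<inter> space (\<F> t) \<in> sets (\<F> t)"
      unfolding space_round sets_round
      by (rule sigma_sets.Basic, rule UnI2)
        (intro CollectI exI[of _ i] exI[of _ s] exI[of _ l] exI[of _ A] conjI refl il)
  qed simp
  ultimately show "x t \<in> borel_measurable (\<F> t)" "i < n \<Longrightarrow> c i t \<in> borel_measurable (\<F> t)"
    "cbar t \<in> borel_measurable (\<F> t)"
    using state_measurable[OF space_round, of t t] by auto
qed

lemma state_measurable_step:
  "x t \<in> borel_measurable (G j t l)" "i < n \<Longrightarrow> c i t \<in> borel_measurable (G j t l)"
  "cbar t \<in> borel_measurable (G j t l)"
  using state_measurable_round measurable_from_subalg[OF round_subalgebra_step] by blast+

lemma batch_measurable_step: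
  assumes k: "k < l"
  shows "Bat i t k \<in> G i t l \<rightarrow>\<^sub>M count_space UNIV"
proof (rule measurableI)
  fix A
  show "Bat i t k -` A \<inter> space (G i t l) \<in> sets (G i t l)"
    unfolding space_step sets_step
    by (rule sigma_sets.Basic, rule UnI2) (intro CollectI exI[of _ k] exI[of _ A] conjI refl k)
qed simp

lemma y_measurable_step: "i < n \<Longrightarrow> k \<le> l \<Longrightarrow> l \<le> H \<Longrightarrow> y i t k \<in> borel_measurable (G i t l)"
  using state_measurable_step batch_measurable_step by (intro y_measurable) (auto simp: space_step)

lemma noise_measurable_step:
  assumes "i < n" "k < l" "l \<le> H"
  shows "noise i t k \<in> borel_measurable (G i t l)"
proof -
  have y: "y i t k \<in> borel_measurable (G i t l)" using assms by (intro y_measurable_step) auto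
  have "(\<lambda>w. sgrad i t k w) \<in> borel_measurable (G i t l)"
    unfolding sgrad_def using assms y batch_subset
    by (intro batch_grad_measurable batch_measurable_step) (auto simp: space_step)
  then show ?thesis
    using grad_measurable[OF smooth_Fi[OF assms(1)] y] unfolding noise_def[abs_def] by auto
qed

subsection \<open>Boundedness\<close>

lemma x_ess_bounded: "ess_bounded M (x t)"
proof (rule ess_boundedI[OF state_measurable_M(1), where C = "norm xstar + R"])
  show "AE w in M. norm (x t w) \<le> norm xstar + R"
    using in_ball
  proof eventually_elim
    case (elim w)
    then have "norm (x t w - xstar) \<le> R" by (auto simp: dist_norm norm_minus_commute)
    then show ?case using norm_triangle_sub[of "x t w" xstar] by linarith
  qed
qed

lemma y_ess_bounded:
  assumes "i < n" "l \<le> H"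
  shows "ess_bounded M (y i t l)"
proof (rule ess_boundedI[OF y_measurable_M[OF assms], where C = "norm xstar + R"])
  show "AE w in M. norm (y i t l w) \<le> norm xstar + R"
    using in_ball
  proof eventually_elim
    case (elim w)
    then have "norm (y i t l w - xstar) \<le> R" using assms by (auto simp: dist_norm norm_minus_commute)
    then show ?case using norm_triangle_sub[of "y i t l w" xstar] by linarith
  qed
qed

lemma grad_ess_bounded:
  assumes f: "L_smooth L f" and z: "ess_bounded M z"
  shows "ess_bounded M (\<lambda>w. grad f (z w))"
proof -
  obtain C where C: "AE w in M. norm (z w) \<le> C" using z by (auto simp: ess_bounded_def)
  show ?thesis
  proof (rule ess_boundedI[where C = "norm (grad f 0) + L * C"])
    show "(\<lambda>w. grad f (z w)) \<in> borel_measurable M"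
      using f z by (intro grad_measurable) (auto simp: ess_bounded_def)
    show "AE w in M. norm (grad f (z w)) \<le> norm (grad f 0) + L * C"
      using C
    proof eventually_elim
      case (elim w)
      have "norm (grad f (z w) - grad f 0) \<le> L * norm (z w - 0)" by (rule L_smooth_lipschitz[OF f])
      also have "\<dots> \<le> L * C" using elim L_pos by simp
      finally show ?case using norm_triangle_sub[of "grad f (z w)" "grad f 0"] by linarith
    qed
  qed
qed

lemma sgrad_ess_bounded:
  assumes i: "i < n" "l < H"
  shows "ess_bounded M (sgrad i t l)"
proof -
  have "ess_bounded M (\<lambda>w. grad (\<phi> i j) (y i t l w))" if "j < m i" for j
    using that i by (intro grad_ess_bounded smooth y_ess_bounded) auto
  then have "\<forall>j<m i. \<exists>C. AE w in M. norm (grad (\<phi> i j) (y i t l w)) \<le> C"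
    by (simp add: ess_bounded_def)
  then obtain C where C: "\<And>j. j < m i \<Longrightarrow> AE w in M. norm (grad (\<phi> i j) (y i t l w)) \<le> C j"
    by metis
  then have "AE w in M. \<forall>j\<in>{..<m i}. norm (grad (\<phi> i j) (y i t l w)) \<le> C j"
    by (intro AE_finite_allI) auto
  then have "AE w in M. norm (sgrad i t l w) \<le> (1 / real b) * (\<Sum>j<m i. C j)"
    using AE_space
  proof eventually_elim
    case (elim w)
    have "norm (sgrad i t l w) \<le> (1 / real b) * (\<Sum>j\<in>Bat i t l w. norm (grad (\<phi> i j) (y i t l w)))"
      unfolding sgrad_def batch_grad_def
      using norm_sum[of "\<lambda>j. grad (\<phi> i j) (y i t l w)" "Bat i t l w"] by (simp add: divide_right_mono)
    also have "\<dots> \<le> (1 / real b) * (\<Sum>j<m i. norm (grad (\<phi> i j) (y i t l w)))"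
      using batch_subset[OF i elim(2)] by (intro mult_left_mono sum_mono2) auto
    also have "\<dots> \<le> (1 / real b) * (\<Sum>j<m i. C j)"
      using elim(1) by (intro mult_left_mono sum_mono) auto
    finally show ?case .
  qed
  then show ?thesis using sgrad_measurable_M[OF i] by (rule ess_boundedI[rotated])
qed

lemma noise_ess_bounded: "i < n \<Longrightarrow> l < H \<Longrightarrow> ess_bounded M (noise i t l)"
  unfolding noise_def[abs_def]
  by (intro ess_bounded_diff sgrad_ess_bounded grad_ess_bounded smooth_Fi y_ess_bounded) auto

lemma gap_nonneg: "0 \<le> F z - F xstar"
  using minimizer[of z] by simp

lemma gap_ess_bounded: "ess_bounded M (\<lambda>w. F (x t w) - F xstar)"
proof (rule ess_boundedI[where C = "norm (grad F xstar) * R + L / 2 * R\<^sup>2"])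
  have "(\<lambda>w. F (x t w)) \<in> borel_measurable M"
    using borel_measurable_continuous_onI[OF L_smooth_continuous[OF smooth_F]] state_measurable_M(1)
    by (rule measurable_compose[rotated])
  then show "(\<lambda>w. F (x t w) - F xstar) \<in> borel_measurable M" by simp
  show "AE w in M. norm (F (x t w) - F xstar) \<le> norm (grad F xstar) * R + L / 2 * R\<^sup>2"
    using in_ball
  proof eventually_elim
    case (elim w)
    let ?d = "x t w - xstar"
    have d: "norm ?d \<le> R" using elim by (auto simp: dist_norm norm_minus_commute)
    have "F (x t w) - F xstar \<le> inner (grad F xstar) ?d + L / 2 * (norm ?d)\<^sup>2"
      using descent_lemma[OF smooth_F, of xstar ?d] by simp
    also have "inner (grad F xstar) ?d \<le> norm (grad F xstar) * norm ?d" by (rule norm_cauchy_schwarz)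
    also have "\<dots> \<le> norm (grad F xstar) * R" using d by (intro mult_left_mono) auto
    also have "L / 2 * (norm ?d)\<^sup>2 \<le> L / 2 * R\<^sup>2"
      using d L_pos by (intro mult_left_mono power_mono) auto
    finally show ?case using gap_nonneg[of "x t w"] by simp
  qed
qed


section \<open>Gradient noise\<close>

lemma noise_orthogonal:
  assumes i: "i < n" "l < H" and Z: "Z \<in> borel_measurable (G i t l)" "ess_bounded M Z"
  shows "(\<integral>w. inner (Z w) (noise i t l w) \<partial>M) = 0"
proof -
  have "AE w in M. vec_cond_exp M (G i t l) (sgrad i t l) w = grad (Fi i) (y i t l w)"
    using unbiased[OF i, of t] by (simp add: sgrad_def[abs_def] batch_grad_def[abs_def])
  then show ?thesis
    unfolding noise_def using i
    by (intro integral_inner_vec_cond_exp[OF step_subalgebra Z(1) _ _ Z(2)] sgrad_ess_bounded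
        grad_ess_bounded smooth_Fi y_ess_bounded) auto
qed

lemma noise_second_moment:
  assumes i: "i < n" "l < H"
  shows "(\<integral>w. (norm (noise i t l w))\<^sup>2 \<partial>M) \<le> v2 / real b"
proof -
  interpret sigma_finite_subalgebra M "G i t l"
    using i by (intro sigma_finite_subalgebra_of_subalgebra step_subalgebra) auto
  have int: "integrable M (\<lambda>w. (norm (noise i t l w))\<^sup>2)"
    using i by (intro ess_bounded_integrable ess_bounded_norm_sq noise_ess_bounded)
  have "AE w in M. real_cond_exp M (G i t l) (\<lambda>w. (norm (noise i t l w))\<^sup>2) w
      \<le> node_var m \<phi> xstar R i / real b"
    using variance[OF i, of t] by (simp add: noise_def sgrad_def batch_grad_def)
  then have "(\<integral>w. real_cond_exp M (G i t l) (\<lambda>w. (norm (noise i t l w))\<^sup>2) w \<partial>M)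
      \<le> (\<integral>w. node_var m \<phi> xstar R i / real b \<partial>M)"
    by (intro integral_mono_AE real_cond_exp_int(1)[OF int]) auto
  also have "\<dots> = node_var m \<phi> xstar R i / real b" by (simp add: prob_space)
  also have "\<dots> \<le> v2 / real b"
    unfolding max_var_def using i by (intro divide_right_mono Max_ge) auto
  finally show ?thesis unfolding real_cond_exp_int(2)[OF int] .
qed

lemma v2_nonneg: "0 \<le> v2"
proof -
  have "0 \<le> (\<integral>w. (norm (noise 0 0 0 w))\<^sup>2 \<partial>M)" by simp
  also have "\<dots> \<le> v2 / real b" using noise_second_moment sizes by simp
  finally show ?thesis using sizes by (simp add: zero_le_divide_iff)
qed

lemma noise_uncorrelated_steps:
  assumes i: "i < n" "k < H" "l < H" and "k \<noteq> l"
  shows "(\<integral>w. inner (noise i t k w) (noise i t l w) \<partial>M) = 0"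
proof (cases "k < l")
  case True
  then show ?thesis using i
    by (intro noise_orthogonal noise_measurable_step noise_ess_bounded) auto
next
  case False
  then have "(\<integral>w. inner (noise i t l w) (noise i t k w) \<partial>M) = 0" using i \<open>k \<noteq> l\<close>
    by (intro noise_orthogonal noise_measurable_step noise_ess_bounded) auto
  then show ?thesis by (simp add: inner_commute)
qed

text \<open>For each fixed sequence \<open>B\<close> of batches, the local iterate that a node would reach with these batches
  is measurable with respect to the past of the round.\<close>

lemma y_along_history:
  assumes i: "i < n"
  shows "l \<le> H \<Longrightarrow> \<exists>Y. (\<forall>B. Y B \<in> borel_measurable (\<F> t)) \<and>
    (\<forall>w\<in>space M. \<forall>B. (\<forall>k<l. B k = Bat i t k w) \<longrightarrow> y i t l w = Y B w)"
proof (induction l)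
  case 0
  show ?case using state_measurable_round(1)[of t] i
    by (intro exI[of _ "\<lambda>_. x t"]) (auto simp: y_0)
next
  case (Suc l)
  then have l: "l \<le> H" by simp
  obtain Y where "(\<forall>B. Y B \<in> borel_measurable (\<F> t)) \<and>
      (\<forall>w\<in>space M. \<forall>B. (\<forall>k<l. B k = Bat i t k w) \<longrightarrow> y i t l w = Y B w)"
    by (rule exE[OF Suc.IH[OF l]])
  then have Y: "\<And>B. Y B \<in> borel_measurable (\<F> t)"
    "\<And>w B. w \<in> space M \<Longrightarrow> (\<forall>k<l. B k = Bat i t k w) \<Longrightarrow> y i t l w = Y B w" by blast+
  \<comment> \<open>Intersecting with the index set changes no actual batch and makes sense of every \<open>B\<close>.\<close>
  define Y' where "Y' B w = Y B w - \<eta> *\<^sub>R (batch_grad i (B l \<inter> {..<m i}) (Y B w) - c i t w + cbar t w)"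
    for B w
  have "Y' B \<in> borel_measurable (\<F> t)" for B
  proof -
    have "(\<lambda>w. batch_grad i (B l \<inter> {..<m i}) (Y B w)) \<in> borel_measurable (\<F> t)"
      using batch_grad_measurable[OF i space_round _ _ Y(1), of "\<lambda>_. B l \<inter> {..<m i}"] by auto
    then show ?thesis
      unfolding Y'_def[abs_def] using Y(1) state_measurable_round i by auto
  qed
  moreover have "y i t (Suc l) w = Y' B w"
    if w: "w \<in> space M" and B: "\<forall>k<Suc l. B k = Bat i t k w" for w B
  proof -
    have "B l \<inter> {..<m i} = Bat i t l w"
      using B batch_subset[OF i _ w, of l t] Suc.prems by (auto simp: Int_absorb2)
    moreover have "y i t l w = Y B w" using Y(2)[OF w] B by simp
    ultimately show ?thesis
      using y_Suc'[OF i _ w, of l t] Suc.prems by (simp add: Y'_def sgrad_def)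
  qed
  ultimately show ?case by blast
qed

lemma noise_along_history:
  assumes i: "i < n" and l: "l < H"
  obtains N where "\<And>B. N B \<in> borel_measurable (\<F> t)"
    and "\<And>w. w \<in> space M \<Longrightarrow> noise i t l w = N (restrict (\<lambda>k. Bat i t k w) {..l}) w"
proof -
  obtain Y where "(\<forall>B. Y B \<in> borel_measurable (\<F> t)) \<and>
      (\<forall>w\<in>space M. \<forall>B. (\<forall>k<l. B k = Bat i t k w) \<longrightarrow> y i t l w = Y B w)"
    by (rule exE[OF y_along_history[OF i less_imp_le[OF l]]])
  then have Y: "\<And>B. Y B \<in> borel_measurable (\<F> t)"
    "\<And>w B. w \<in> space M \<Longrightarrow> (\<forall>k<l. B k = Bat i t k w) \<Longrightarrow> y i t l w = Y B w" by blast+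
  define N where "N B w = batch_grad i (B l \<inter> {..<m i}) (Y B w) - grad (Fi i) (Y B w)" for B w
  show thesis
  proof
    show "N B \<in> borel_measurable (\<F> t)" for B
    proof -
      have "(\<lambda>w. batch_grad i (B l \<inter> {..<m i}) (Y B w)) \<in> borel_measurable (\<F> t)"
        using batch_grad_measurable[OF i space_round _ _ Y(1), of "\<lambda>_. B l \<inter> {..<m i}"] by auto
      then show ?thesis
        unfolding N_def[abs_def] using grad_measurable[OF smooth_Fi[OF i] Y(1)] by auto
    qed
    show "noise i t l w = N (restrict (\<lambda>k. Bat i t k w) {..l}) w" if w: "w \<in> space M" for w
    proof -
      let ?B = "restrict (\<lambda>k. Bat i t k w) {..l}"
      have "?B l \<inter> {..<m i} = Bat i t l w"
        using batch_subset[OF i l w, of t] by (auto simp: Int_absorb2)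
      moreover have "y i t l w = Y ?B w" by (rule Y(2)[OF w]) auto
      ultimately show ?thesis by (simp add: N_def noise_def sgrad_def)
    qed
  qed
qed

lemma noise_component_centred:
  assumes i: "i < n" "l < H"
  shows "AE w in M. real_cond_exp M (G i t 0) (\<lambda>w. noise i t l w $ k) w = 0"
proof -
  interpret sigma_finite_subalgebra M "G i t 0"
    using i by (intro sigma_finite_subalgebra_of_subalgebra step_subalgebra) auto
  show ?thesis
  proof (rule real_cond_exp_charact)
    fix A assume A: "A \<in> sets (G i t 0)"
    have AG: "A \<in> sets (G i t l)" "A \<in> sets M"
      using A step_subalgebra_step[of 0 l i t] step_subalgebra[of i 0 t] i by (auto simp: subalgebra_def)
    let ?Z = "\<lambda>w. indicator A w *\<^sub>R axis k 1 :: real ^ 'd"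
    have "(\<integral>w. inner (?Z w) (noise i t l w) \<partial>M) = 0"
    proof (rule noise_orthogonal[OF i])
      show "?Z \<in> borel_measurable (G i t l)" using AG by auto
      show "ess_bounded M ?Z"
        using AG by (intro ess_boundedI[where C = 1]) (auto simp: indicator_def)
    qed
    then show "(\<integral>w\<in>A. noise i t l w $ k \<partial>M) = (\<integral>w\<in>A. 0 \<partial>M)"
      by (simp add: set_lebesgue_integral_def inner_axis')
  next
    show "integrable M (\<lambda>w. noise i t l w $ k)"
      using i by (intro ess_bounded_integrable ess_bounded_component noise_ess_bounded)
  qed auto
qed

text \<open>The noises of two nodes are uncorrelated: given the past of the round they are functions of
  disjoint, hence conditionally independent, collections of batches.\<close>

lemma noise_uncorrelated_nodes:
  assumes ij: "i < n" "j < n" "i \<noteq> j" and lk: "l < H" "l' < H"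
  shows "(\<integral>w. inner (noise i t l w) (noise j t l' w) \<partial>M) = 0"
proof -
  obtain N where N: "\<And>B. N B \<in> borel_measurable (\<F> t)"
    "\<And>w. w \<in> space M \<Longrightarrow> noise i t l w = N (restrict (\<lambda>k. Bat i t k w) {..l}) w"
    using noise_along_history[OF ij(1) lk(1)] by blast
  obtain N' where N': "\<And>B. N' B \<in> borel_measurable (\<F> t)"
    "\<And>w. w \<in> space M \<Longrightarrow> noise j t l' w = N' (restrict (\<lambda>k. Bat j t k w) {..l'}) w"
    using noise_along_history[OF ij(2) lk(2)] by blast
  define U where "U w = restrict (\<lambda>k. Bat i t k w) {..l}" for w
  define V where "V w = restrict (\<lambda>k. Bat j t k w) {..l'}" for w
  define SU where "SU = PiE {..l} (\<lambda>_. Pow {..<m i})"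
  define SV where "SV = PiE {..l'} (\<lambda>_. Pow {..<m j})"
  have ind: "indicator {a} (restrict (\<lambda>k. Bat p t k w) {..q}) = (\<Prod>k\<le>q. indicator {a k} (Bat p t k w) :: real)"
    if ext: "a \<in> extensional {..q}" for a p q w
  proof (cases "restrict (\<lambda>k. Bat p t k w) {..q} = a")
    case True
    then have "Bat p t k w = a k" if "k \<le> q" for k using that by (auto simp: fun_eq_iff split: if_splits)
    then show ?thesis using True by (simp add: indicator_def)
  next
    case False
    have "\<not> (\<forall>k\<le>q. Bat p t k w = a k)"
    proof
      assume "\<forall>k\<le>q. Bat p t k w = a k"
      then have "restrict (\<lambda>k. Bat p t k w) {..q} = a"
        by (intro extensionalityI[OF restrict_extensional ext]) simp
      with False show False ..
    qed
    then obtain k where "k \<le> q" "Bat p t k w \<noteq> a k" by blast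
    then have "(\<Prod>k\<le>q. indicator {a k} (Bat p t k w) :: real) = 0"
      by (intro prod_zero) (auto simp: indicator_def)
    then show ?thesis using False by (simp add: indicator_def)
  qed
  have meas: "(\<lambda>w. indicator {S} (Bat p t k w) :: real) \<in> borel_measurable M" if "p < n" "k < H" for S p k
    by (rule measurable_compose[OF batch_measurable[OF that]]) simp
  have SUe: "a \<in> extensional {..l}" if "a \<in> SU" for a using that by (auto simp: SU_def PiE_def)
  have SVe: "a \<in> extensional {..l'}" if "a \<in> SV" for a using that by (auto simp: SV_def PiE_def)
  \<comment> \<open>\<open>U\<close> and \<open>V\<close> are the batch histories of the two nodes, and \<open>G i t 0\<close> is the past of the round.\<close>
  have comp: "(\<integral>w. noise i t l w $ k * noise j t l' w $ k \<partial>M) = 0" for k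
  proof -
    have "(\<integral>w. N (U w) w $ k * N' (V w) w $ k \<partial>M) = 0"
    proof (rule cond_indep_uncorrelated[where K = "G i t 0" and SU = SU and SV = SV
          and f = "\<lambda>B w. N B w $ k" and h = "\<lambda>B w. N' B w $ k" and U = U and V = V])
      show "subalgebra M (G i t 0)" using ij by (intro step_subalgebra) auto
      show "finite SU" "finite SV" by (auto simp: SU_def SV_def intro: finite_PiE)
      show "U w \<in> SU" if "w \<in> space M" for w
        using batch_subset[OF ij(1) _ that] lk by (auto simp: U_def SU_def)
      show "V w \<in> SV" if "w \<in> space M" for w
        using batch_subset[OF ij(2) _ that] lk by (auto simp: V_def SV_def)
      show "(\<lambda>w. indicator {a} (U w) :: real) \<in> borel_measurable M" if "a \<in> SU" for a
        unfolding U_def ind[OF SUe[OF that]] using ij lk by (intro borel_measurable_prod meas) auto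
      show "(\<lambda>w. indicator {a} (V w) :: real) \<in> borel_measurable M" if "a \<in> SV" for a
        unfolding V_def ind[OF SVe[OF that]] using ij lk by (intro borel_measurable_prod meas) auto
      have "(\<lambda>w. N B w $ k) \<in> borel_measurable (G i t 0)" "(\<lambda>w. N' B w $ k) \<in> borel_measurable (G i t 0)" for B
        using borel_measurable_inner[OF measurable_from_subalg[OF round_subalgebra_step N(1)[of B]], of "\<lambda>_. axis k 1"]
          borel_measurable_inner[OF measurable_from_subalg[OF round_subalgebra_step N'(1)[of B]], of "\<lambda>_. axis k 1"]
        by (simp_all add: inner_axis)
      then show "\<And>a. (\<lambda>w. N a w $ k) \<in> borel_measurable (G i t 0)"
        "\<And>a. (\<lambda>w. N' a w $ k) \<in> borel_measurable (G i t 0)" by auto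
      show "AE w in M. real_cond_exp M (G i t 0) (\<lambda>w. indicator {a} (U w) * indicator {a'} (V w)) w =
          real_cond_exp M (G i t 0) (\<lambda>w. indicator {a} (U w)) w *
          real_cond_exp M (G i t 0) (\<lambda>w. indicator {a'} (V w)) w"
        if a: "a \<in> SU" and a': "a' \<in> SV" for a a'
      proof -
        define A where "A p = (if fst p = i then {a (snd p)} else {a' (snd p)})" for p :: "nat \<times> nat"
        have slice: "(\<Prod>p\<in>{i'} \<times> S. g p) = (\<Prod>k\<in>S. g (i', k))"
          for i' and S :: "nat set" and g :: "nat \<times> nat \<Rightarrow> real"
          by (rule prod.reindex_bij_witness[of _ "Pair i'" snd]) auto
        have PU: "indicator {a} (U w) = (\<Prod>p\<in>{i} \<times> {..l}. indicator (A p) ((\<lambda>(j, k). Bat j t k) p w) :: real)" for w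
          unfolding U_def ind[OF SUe[OF a]] slice by (simp add: A_def)
        have PV: "indicator {a'} (V w) = (\<Prod>p\<in>{j} \<times> {..l'}. indicator (A p) ((\<lambda>(j, k). Bat j t k) p w) :: real)" for w
          unfolding V_def ind[OF SVe[OF a']] slice using ij by (simp add: A_def)
        show ?thesis
          unfolding PU PV
          by (rule cond_indep_discrete_disjoint[OF batch_indep[of i 0 t]]) (use ij lk in auto)
      qed
      have "ess_bounded M (\<lambda>w. noise i t l w $ k)" "ess_bounded M (\<lambda>w. noise j t l' w $ k)"
        using ij lk by (auto intro!: ess_bounded_component noise_ess_bounded)
      then show "ess_bounded M (\<lambda>w. N (U w) w $ k)" "ess_bounded M (\<lambda>w. N' (V w) w $ k)"
        using N(2) N'(2) by (auto simp: ess_bounded_def U_def V_def cong: measurable_cong AE_cong)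
      have m: "(\<lambda>w. noise i t l w $ k) \<in> borel_measurable M"
        by (intro ess_bounded_measurable ess_bounded_component noise_ess_bounded ij lk)
      moreover have eq: "noise i t l w $ k = N (U w) w $ k" if "w \<in> space M" for w
        using N(2)[OF that] by (simp add: U_def)
      ultimately have m': "(\<lambda>w. N (U w) w $ k) \<in> borel_measurable M"
        by (simp cong: measurable_cong)
      interpret sigma_finite_subalgebra M "G i t 0"
        using ij by (intro sigma_finite_subalgebra_of_subalgebra step_subalgebra) auto
      have "AE w in M. real_cond_exp M (G i t 0) (\<lambda>w. noise i t l w $ k) w
          = real_cond_exp M (G i t 0) (\<lambda>w. N (U w) w $ k) w"
        using eq m m' by (intro real_cond_exp_cong) auto
      then show "AE w in M. real_cond_exp M (G i t 0) (\<lambda>w. N (U w) w $ k) w = 0"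
        using noise_component_centred[OF ij(1) lk(1), of t k] by eventually_elim simp
    qed
    moreover have "(\<integral>w. noise i t l w $ k * noise j t l' w $ k \<partial>M) = (\<integral>w. N (U w) w $ k * N' (V w) w $ k \<partial>M)"
      by (intro Bochner_Integration.integral_cong refl) (simp add: N(2) N'(2) U_def V_def)
    ultimately show ?thesis by simp
  qed
  have "(\<integral>w. inner (noise i t l w) (noise j t l' w) \<partial>M)
      = (\<integral>w. (\<Sum>k\<in>UNIV. noise i t l w $ k * noise j t l' w $ k) \<partial>M)"
    by (simp add: inner_vec_def)
  also have "\<dots> = (\<Sum>k\<in>UNIV. \<integral>w. noise i t l w $ k * noise j t l' w $ k \<partial>M)"
  proof (intro Bochner_Integration.integral_sum)
    fix k
    have "ess_bounded M (\<lambda>w. inner (noise i t l w $ k) (noise j t l' w $ k))"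
      using ij lk by (intro ess_bounded_inner ess_bounded_component noise_ess_bounded)
    then show "integrable M (\<lambda>w. noise i t l w $ k * noise j t l' w $ k)"
      using ess_bounded_integrable by simp
  qed
  finally show ?thesis by (simp add: comp)
qed

text \<open>All noises of a round being pairwise uncorrelated, the second moment of a sum of noises grows only
  linearly in the number of summands.\<close>

lemma noise_sum_second_moment:
  assumes P: "P \<subseteq> {..<n} \<times> {..<H}"
  shows "(\<integral>w. (norm (\<Sum>(i, l)\<in>P. noise i t l w))\<^sup>2 \<partial>M) \<le> real (card P) * (v2 / real b)"
proof -
  have fin: "finite P" using P by (rule finite_subset) auto
  have "(\<integral>w. (norm (\<Sum>p\<in>P. noise (fst p) t (snd p) w))\<^sup>2 \<partial>M)
      = (\<Sum>p\<in>P. \<integral>w. (norm (noise (fst p) t (snd p) w))\<^sup>2 \<partial>M)"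
  proof (rule integral_norm_sum_orthogonal[OF fin])
    show "ess_bounded M (noise (fst p) t (snd p))" if "p \<in> P" for p
      using P that by (intro noise_ess_bounded) auto
    fix p q assume pq: "p \<in> P" "q \<in> P" "p \<noteq> q"
    then have "fst p < n" "snd p < H" "fst q < n" "snd q < H" using P by auto
    moreover have "fst p \<noteq> fst q \<or> snd p \<noteq> snd q" using pq(3) by (simp add: prod_eq_iff)
    ultimately show "(\<integral>w. inner (noise (fst p) t (snd p) w) (noise (fst q) t (snd q) w) \<partial>M) = 0"
      using noise_uncorrelated_nodes noise_uncorrelated_steps
      by (cases "fst p = fst q") auto
  qed
  also have "\<dots> \<le> (\<Sum>p\<in>P. v2 / real b)"
    using P by (intro sum_mono noise_second_moment) auto
  finally show ?thesis by (simp add: case_prod_beta)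
qed

end

section \<open>One round of the algorithm\<close>

context controller_run
begin

text \<open>\<open>gap\<close> is the expected objective gap, \<open>sigma2\<close> bounds the second moment of the noise averaged over
  the local steps of one node.\<close>

definition gap :: "nat \<Rightarrow> real" where
  "gap t = (\<integral>w. (F (x t w) - F xstar) \<partial>M)"

definition sigma2 :: real where
  "sigma2 = v2 / (real H * real b)"

text \<open>\<open>err_bound t Q\<close>: the control errors at round \<open>t\<close> have second moments at most \<open>Q\<close>. Integrability
  is part of the condition, since the integral of a non-integrable function is \<open>0\<close>.\<close>

definition err_bound :: "nat \<Rightarrow> real \<Rightarrow> bool" where
  "err_bound t Q \<longleftrightarrow> (\<forall>i<n. integrable M (\<lambda>w. (norm (err i t w))\<^sup>2) \<and>
     (\<integral>w. (norm (err i t w))\<^sup>2 \<partial>M) \<le> Q)"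

text \<open>The bound on \<open>L\<^sup>2 E|y - x|\<^sup>2\<close> for the local iterates \<open>y\<close> of a round started at \<open>x\<close> with
  control errors bounded by \<open>Q\<close>.\<close>

definition drift_bound :: "nat \<Rightarrow> real \<Rightarrow> real" where
  "drift_bound t Q = 3 * \<theta>\<^sup>2 * sigma2 + 24 * \<theta>\<^sup>2 * Q + 24 * L * \<theta>\<^sup>2 * gap t"

lemma gap_expectation_nonneg: "0 \<le> gap t"
  unfolding gap_def using gap_nonneg by (intro integral_nonneg_AE) auto

lemma gap_integrable: "integrable M (\<lambda>w. F (x t w) - F xstar)"
  by (intro ess_bounded_integrable gap_ess_bounded)

lemma sigma2_nonneg: "0 \<le> sigma2"
  unfolding sigma2_def using v2_nonneg by simp

lemma err_bound_nonneg:
  assumes "err_bound t Q"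
  shows "0 \<le> Q"
proof -
  have "0 \<le> (\<integral>w. (norm (err 0 t w))\<^sup>2 \<partial>M)" by simp
  then show ?thesis using assms sizes unfolding err_bound_def by (meson order_trans)
qed

lemma drift_integrable:
  "i < n \<Longrightarrow> l \<le> H \<Longrightarrow> integrable M (\<lambda>w. (norm (y i t l w - x t w))\<^sup>2)"
  by (intro ess_bounded_integrable ess_bounded_norm_sq ess_bounded_diff y_ess_bounded x_ess_bounded)

lemma noise_sum_ess_bounded:
  "i < n \<Longrightarrow> l \<le> H \<Longrightarrow> ess_bounded M (\<lambda>w. \<Sum>k<l. noise i t k w)"
  by (intro ess_bounded_sum noise_ess_bounded) auto

lemma noise_node_sum_second_moment:
  assumes "i < n" "l \<le> H"
  shows "(\<integral>w. (norm (\<Sum>k<l. noise i t k w))\<^sup>2 \<partial>M) \<le> real l * (v2 / real b)"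
proof -
  have "(\<Sum>(j, k)\<in>{i} \<times> {..<l}. noise j t k w) = (\<Sum>k<l. noise i t k w)" for w
    by (simp add: sum.cartesian_product[symmetric])
  moreover have "{i} \<times> {..<l} \<subseteq> {..<n} \<times> {..<H}" using assms by auto
  ultimately show ?thesis using noise_sum_second_moment[of "{i} \<times> {..<l}" t] by simp
qed

text \<open>The drift inside a round: the controls correct the local gradients up to the control errors, so
  that each local step moves along noise, local drift, control errors and the global gradient.\<close>

lemma drift_pointwise:
  assumes i: "i < n" and l: "l \<le> H" and w: "w \<in> space M"
  shows "(norm (y i t l w - x t w))\<^sup>2
    \<le> 2 * \<eta>\<^sup>2 * (norm (\<Sum>k<l. noise i t k w))\<^sup>2 + 8 * \<eta>\<^sup>2 * real l * (\<Sum>k<l.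
        L\<^sup>2 * (norm (y i t k w - x t w))\<^sup>2 + (norm (err i t w))\<^sup>2
        + (1 / real n) * (\<Sum>j<n. (norm (err j t w))\<^sup>2) + 2 * L * (F (x t w) - F xstar))"
proof -
  \<comment> \<open>\<open>D k\<close> is the part of the \<open>k\<close>-th local step that is not noise.\<close>
  define D where "D k = (grad (Fi i) (y i t k w) - grad (Fi i) (x t w)) + - err i t w
      + (1 / real n) *\<^sub>R (\<Sum>j<n. err j t w) + grad F (x t w)" for k
  define T where "T k = L\<^sup>2 * (norm (y i t k w - x t w))\<^sup>2 + (norm (err i t w))\<^sup>2
      + (1 / real n) * (\<Sum>j<n. (norm (err j t w))\<^sup>2) + 2 * L * (F (x t w) - F xstar)" for k
  have D_le: "(norm (D k))\<^sup>2 \<le> 4 * T k" for k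
  proof -
    have "(norm (grad (Fi i) (y i t k w) - grad (Fi i) (x t w)))\<^sup>2 \<le> (L * norm (y i t k w - x t w))\<^sup>2"
      by (intro power_mono L_smooth_lipschitz smooth_Fi i) simp
    then have 1: "(norm (grad (Fi i) (y i t k w) - grad (Fi i) (x t w)))\<^sup>2 \<le> L\<^sup>2 * (norm (y i t k w - x t w))\<^sup>2"
      by (simp add: power_mult_distrib)
    have 2: "(norm ((1 / real n) *\<^sub>R (\<Sum>j<n. err j t w)))\<^sup>2 \<le> (1 / real n) * (\<Sum>j<n. (norm (err j t w))\<^sup>2)"
      by (rule norm_average_sq_le[OF sizes(1)])
    have 3: "(norm (grad F (x t w)))\<^sup>2 \<le> 2 * L * (F (x t w) - F xstar)"
      by (rule grad_norm_le_gap[OF smooth_F L_pos minimizer])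
    have "(norm (D k))\<^sup>2 \<le> 4 * ((norm (grad (Fi i) (y i t k w) - grad (Fi i) (x t w)))\<^sup>2
        + (norm (err i t w))\<^sup>2 + (norm ((1 / real n) *\<^sub>R (\<Sum>j<n. err j t w)))\<^sup>2 + (norm (grad F (x t w)))\<^sup>2)"
      using norm_add4_sq_le[of "grad (Fi i) (y i t k w) - grad (Fi i) (x t w)" "- err i t w"
          "(1 / real n) *\<^sub>R (\<Sum>j<n. err j t w)" "grad F (x t w)"]
      unfolding D_def[symmetric] norm_minus_cancel .
    also have "\<dots> \<le> 4 * T k"
      unfolding T_def by (rule mult_left_mono[OF add_mono[OF add_mono[OF add_mono[OF 1 order_refl] 2] 3]]) simp
    finally show ?thesis .
  qed
  have "(norm (\<Sum>k<l. D k))\<^sup>2 \<le> real l * (\<Sum>k<l. (norm (D k))\<^sup>2)"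
    using norm_sum_sq_le[of "{..<l}" D] by simp
  also have "\<dots> \<le> real l * (\<Sum>k<l. 4 * T k)" by (intro mult_left_mono sum_mono D_le) simp
  finally have D_sum: "(norm (\<Sum>k<l. D k))\<^sup>2 \<le> real l * (4 * (\<Sum>k<l. T k))"
    by (simp only: sum_distrib_left)
  have "sgrad i t k w - c i t w + cbar t w = noise i t k w + D k" for k
    unfolding D_def err_average[OF w] by (simp add: noise_def err_def)
  then have "y i t l w - x t w = - (\<eta> *\<^sub>R ((\<Sum>k<l. noise i t k w) + (\<Sum>k<l. D k)))"
    using y_eq[OF i l w, of t] by (simp add: sum.distrib)
  then have "(norm (y i t l w - x t w))\<^sup>2 = \<eta>\<^sup>2 * (norm ((\<Sum>k<l. noise i t k w) + (\<Sum>k<l. D k)))\<^sup>2"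
    by (simp add: power_mult_distrib)
  also have "\<dots> \<le> \<eta>\<^sup>2 * (2 * (norm (\<Sum>k<l. noise i t k w))\<^sup>2 + 2 * (norm (\<Sum>k<l. D k))\<^sup>2)"
    by (intro mult_left_mono norm_add_sq_le) auto
  also have "\<dots> \<le> \<eta>\<^sup>2 * (2 * (norm (\<Sum>k<l. noise i t k w))\<^sup>2 + 2 * (real l * (4 * (\<Sum>k<l. T k))))"
    by (intro mult_left_mono add_mono order_refl D_sum) auto
  also have "\<dots> = 2 * \<eta>\<^sup>2 * (norm (\<Sum>k<l. noise i t k w))\<^sup>2 + 8 * \<eta>\<^sup>2 * real l * (\<Sum>k<l. T k)"
    by (simp add: distrib_left)
  finally show ?thesis unfolding T_def .
qed

lemma drift_le:
  assumes Q: "err_bound t Q" and i: "i < n"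
  shows "l \<le> H \<Longrightarrow> L\<^sup>2 * (\<integral>w. (norm (y i t l w - x t w))\<^sup>2 \<partial>M) \<le> drift_bound t Q"
proof (induction l rule: less_induct)
  case (less l)
  note l = less.prems
  let ?K = "drift_bound t Q"
  have int_err: "integrable M (\<lambda>w. (norm (err j t w))\<^sup>2)"
    and err_le: "(\<integral>w. (norm (err j t w))\<^sup>2 \<partial>M) \<le> Q" if "j < n" for j
    using Q that by (auto simp: err_bound_def)
  have int_avg: "integrable M (\<lambda>w. (1 / real n) * (\<Sum>j<n. (norm (err j t w))\<^sup>2))"
    using int_err by (intro integrable_mult_right Bochner_Integration.integrable_sum) auto
  have avg_le: "(\<integral>w. (1 / real n) * (\<Sum>j<n. (norm (err j t w))\<^sup>2) \<partial>M) \<le> Q"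
  proof -
    have "(\<integral>w. (1 / real n) * (\<Sum>j<n. (norm (err j t w))\<^sup>2) \<partial>M)
        = (1 / real n) * (\<Sum>j<n. \<integral>w. (norm (err j t w))\<^sup>2 \<partial>M)"
      using int_err by (simp add: Bochner_Integration.integral_sum)
    also have "\<dots> \<le> (1 / real n) * (\<Sum>j<n. Q)" using err_le by (intro mult_left_mono sum_mono) auto
    also have "\<dots> = Q" using sizes by simp
    finally show ?thesis .
  qed
  define T where "T k w = L\<^sup>2 * (norm (y i t k w - x t w))\<^sup>2 + (norm (err i t w))\<^sup>2
      + (1 / real n) * (\<Sum>j<n. (norm (err j t w))\<^sup>2) + 2 * L * (F (x t w) - F xstar)" for k w
  have T_int: "integrable M (T k)" if "k < l" for k
    unfolding T_def[abs_def] using that l i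
    by (intro Bochner_Integration.integrable_add integrable_mult_right gap_integrable drift_integrable
        int_err int_avg) auto
  have T_le: "(\<integral>w. T k w \<partial>M) \<le> ?K + Q + Q + 2 * L * gap t" if k: "k < l" for k
  proof -
    have "(\<integral>w. T k w \<partial>M) = L\<^sup>2 * (\<integral>w. (norm (y i t k w - x t w))\<^sup>2 \<partial>M) + (\<integral>w. (norm (err i t w))\<^sup>2 \<partial>M)
        + (\<integral>w. (1 / real n) * (\<Sum>j<n. (norm (err j t w))\<^sup>2) \<partial>M) + 2 * L * gap t"
    proof -
      have 1: "integrable M (\<lambda>w. L\<^sup>2 * (norm (y i t k w - x t w))\<^sup>2)"
        using k l i by (intro integrable_mult_right drift_integrable) auto
      have 2: "integrable M (\<lambda>w. L\<^sup>2 * (norm (y i t k w - x t w))\<^sup>2 + (norm (err i t w))\<^sup>2)"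
        by (rule Bochner_Integration.integrable_add[OF 1 int_err[OF i]])
      have 3: "integrable M (\<lambda>w. L\<^sup>2 * (norm (y i t k w - x t w))\<^sup>2 + (norm (err i t w))\<^sup>2
          + (1 / real n) * (\<Sum>j<n. (norm (err j t w))\<^sup>2))"
        by (rule Bochner_Integration.integrable_add[OF 2 int_avg])
      have 4: "integrable M (\<lambda>w. 2 * L * (F (x t w) - F xstar))"
        by (intro integrable_mult_right gap_integrable)
      show ?thesis
        unfolding T_def gap_def Bochner_Integration.integral_add[OF 3 4]
          Bochner_Integration.integral_add[OF 2 int_avg]
          Bochner_Integration.integral_add[OF 1 int_err[OF i]]
        by (simp only: integral_mult_right_zero)
    qed
    then show ?thesis using less.IH[OF k] k l err_le[OF i] avg_le by linarith
  qed
  have noise_int: "integrable M (\<lambda>w. (norm (\<Sum>k<l. noise i t k w))\<^sup>2)"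
    using i l by (intro ess_bounded_integrable ess_bounded_norm_sq noise_sum_ess_bounded)
  have "(\<integral>w. (norm (y i t l w - x t w))\<^sup>2 \<partial>M)
      \<le> (\<integral>w. 2 * \<eta>\<^sup>2 * (norm (\<Sum>k<l. noise i t k w))\<^sup>2 + 8 * \<eta>\<^sup>2 * real l * (\<Sum>k<l. T k w) \<partial>M)"
  proof (rule integral_mono[OF drift_integrable[OF i l]])
    show "integrable M (\<lambda>w. 2 * \<eta>\<^sup>2 * (norm (\<Sum>k<l. noise i t k w))\<^sup>2 + 8 * \<eta>\<^sup>2 * real l * (\<Sum>k<l. T k w))"
      using noise_int T_int by (intro Bochner_Integration.integrable_add integrable_mult_right
        Bochner_Integration.integrable_sum) auto
  qed (unfold T_def, rule drift_pointwise[OF i l])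
  also have "\<dots> = 2 * \<eta>\<^sup>2 * (\<integral>w. (norm (\<Sum>k<l. noise i t k w))\<^sup>2 \<partial>M)
      + 8 * \<eta>\<^sup>2 * real l * (\<Sum>k<l. \<integral>w. T k w \<partial>M)"
  proof -
    have 1: "integrable M (\<lambda>w. 2 * \<eta>\<^sup>2 * (norm (\<Sum>k<l. noise i t k w))\<^sup>2)"
      using noise_int by (rule integrable_mult_right)
    have 2: "integrable M (\<lambda>w. 8 * \<eta>\<^sup>2 * real l * (\<Sum>k<l. T k w))"
      using T_int by (intro integrable_mult_right Bochner_Integration.integrable_sum) auto
    have 3: "(\<integral>w. (\<Sum>k<l. T k w) \<partial>M) = (\<Sum>k<l. \<integral>w. T k w \<partial>M)"
      using T_int by (intro Bochner_Integration.integral_sum) auto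
    show ?thesis
      unfolding Bochner_Integration.integral_add[OF 1 2] integral_mult_right_zero 3 ..
  qed
  also have "\<dots> \<le> 2 * \<eta>\<^sup>2 * (real H * (v2 / real b))
      + 8 * \<eta>\<^sup>2 * real H * (real H * (?K + Q + Q + 2 * L * gap t))"
  proof (intro add_mono mult_left_mono)
    have "(\<integral>w. (norm (\<Sum>k<l. noise i t k w))\<^sup>2 \<partial>M) \<le> real l * (v2 / real b)"
      by (rule noise_node_sum_second_moment[OF i l])
    also have "\<dots> \<le> real H * (v2 / real b)" using l v2_nonneg by (intro mult_right_mono) auto
    finally show "(\<integral>w. (norm (\<Sum>k<l. noise i t k w))\<^sup>2 \<partial>M) \<le> real H * (v2 / real b)" .
    have K0: "0 \<le> ?K + Q + Q + 2 * L * gap t"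
      using err_bound_nonneg[OF Q] gap_expectation_nonneg[of t] L_pos sigma2_nonneg
      by (simp add: drift_bound_def)
    have "(\<Sum>k<l. \<integral>w. T k w \<partial>M) \<le> (\<Sum>k<l. ?K + Q + Q + 2 * L * gap t)"
      using T_le by (intro sum_mono) auto
    also have "\<dots> \<le> real H * (?K + Q + Q + 2 * L * gap t)"
      using l K0 by (simp add: mult_right_mono)
    finally have S: "(\<Sum>k<l. \<integral>w. T k w \<partial>M) \<le> real H * (?K + Q + Q + 2 * L * gap t)" .
    have "8 * \<eta>\<^sup>2 * real l * (\<Sum>k<l. \<integral>w. T k w \<partial>M)
        \<le> 8 * \<eta>\<^sup>2 * real l * (real H * (?K + Q + Q + 2 * L * gap t))"
      using S by (intro mult_left_mono) auto
    also have "\<dots> \<le> 8 * \<eta>\<^sup>2 * real H * (real H * (?K + Q + Q + 2 * L * gap t))"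
      using l K0 by (intro mult_right_mono mult_left_mono mult_nonneg_nonneg) auto
    finally show "8 * \<eta>\<^sup>2 * real l * (\<Sum>k<l. \<integral>w. T k w \<partial>M)
        \<le> 8 * \<eta>\<^sup>2 * real H * (real H * (?K + Q + Q + 2 * L * gap t))" .
  qed auto
  finally have "L\<^sup>2 * (\<integral>w. (norm (y i t l w - x t w))\<^sup>2 \<partial>M)
      \<le> L\<^sup>2 * (2 * \<eta>\<^sup>2 * (real H * (v2 / real b))
        + 8 * \<eta>\<^sup>2 * real H * (real H * (?K + Q + Q + 2 * L * gap t)))"
    by (rule mult_left_mono) simp
  also have "\<dots> = 2 * \<theta>\<^sup>2 * sigma2 + 8 * \<theta>\<^sup>2 * ?K + 16 * \<theta>\<^sup>2 * Q + 16 * L * \<theta>\<^sup>2 * gap t"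
  proof -
    have "L\<^sup>2 * \<eta>\<^sup>2 = \<theta>\<^sup>2 / (real H)\<^sup>2"
      using L_pos by (simp add: \<eta>_def power_divide power_mult_distrib)
    then have e: "L\<^sup>2 * \<eta>\<^sup>2 * real H * real H = \<theta>\<^sup>2"
      using sizes by (simp add: power2_eq_square)
    have hv: "real H * (v2 / real b) = real H * (real H * sigma2)"
      using sizes by (simp add: sigma2_def)
    have "L\<^sup>2 * (2 * \<eta>\<^sup>2 * (real H * (v2 / real b)) + 8 * \<eta>\<^sup>2 * real H * (real H * (?K + Q + Q + 2 * L * gap t)))
      = 2 * (L\<^sup>2 * \<eta>\<^sup>2 * real H * real H) * sigma2
        + 8 * (L\<^sup>2 * \<eta>\<^sup>2 * real H * real H) * (?K + Q + Q + 2 * L * gap t)"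
      unfolding hv by algebra
    then show ?thesis unfolding e by (simp add: algebra_simps)
  qed
  also have "\<dots> \<le> ?K"
  proof -
    \<comment> \<open>Closing the induction needs only \<open>8 \<theta>\<^sup>2 \<le> 1 / 3\<close>.\<close>
    have "0 \<le> ?K" using err_bound_nonneg[OF Q] gap_expectation_nonneg[of t] L_pos sigma2_nonneg
      by (simp add: drift_bound_def)
    then have "8 * \<theta>\<^sup>2 * ?K \<le> 1 / 3 * ?K" using amplitude by (intro mult_right_mono) auto
    moreover have "2 * \<theta>\<^sup>2 * sigma2 + 16 * \<theta>\<^sup>2 * Q + 16 * L * \<theta>\<^sup>2 * gap t = 2 / 3 * ?K"
      by (simp add: drift_bound_def)
    ultimately show ?thesis by argo
  qed
  finally show ?case .
qed

subsection \<open>The control error\<close>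

lemma err_Suc_eq:
  assumes i: "i < n" and w: "w \<in> space M"
  shows "err i (Suc t) w = (1 / real H) *\<^sub>R (\<Sum>l<H. noise i t l w)
    + (1 / real H) *\<^sub>R (\<Sum>l<H. grad (Fi i) (y i t l w) - grad (Fi i) (x t w))
    + (grad (Fi i) (x t w) - grad (Fi i) (x (Suc t) w))"
proof -
  have "(1 / real H) *\<^sub>R (\<Sum>l<H. noise i t l w)
      + (1 / real H) *\<^sub>R (\<Sum>l<H. grad (Fi i) (y i t l w) - grad (Fi i) (x t w))
    = (1 / real H) *\<^sub>R (\<Sum>l<H. sgrad i t l w) - grad (Fi i) (x t w)"
    using sizes
    by (simp add: noise_def sum_subtractf scaleR_diff_right sum_constant_scaleR del: sum_constant)
  then show ?thesis by (simp add: err_def c_Suc_eq[OF i w])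
qed

lemma x_step_sq_le:
  assumes "w \<in> space M"
  shows "(norm (x (Suc t) w - x t w))\<^sup>2 \<le> (1 / real n) * (\<Sum>i<n. (norm (y i t H w - x t w))\<^sup>2)"
  using norm_average_sq_le[OF sizes(1), of "\<lambda>i. y i t H w - x t w"] x_Suc[OF assms, of t] by simp

lemma err_recursion:
  assumes Q: "err_bound t Q"
  shows "err_bound (Suc t) (A_q H b v2 + B_q L \<theta> * gap t + C_q \<theta> * Q)"
  unfolding err_bound_def
proof (intro allI impI conjI)
  fix i assume i: "i < n"
  let ?Y = "\<lambda>j l w. (norm (y j t l w - x t w))\<^sup>2"
  have eb: "ess_bounded M (err i (Suc t))"
  proof -
    have "ess_bounded M (\<lambda>w. (1 / real H) *\<^sub>R (\<Sum>l<H. sgrad i t l w) - grad (Fi i) (x (Suc t) w))"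
      using i by (intro ess_bounded_diff ess_bounded_scaleR ess_bounded_sum sgrad_ess_bounded
          grad_ess_bounded smooth_Fi x_ess_bounded) auto
    then show ?thesis
      using c_Suc_eq[OF i, of _ t]
      by (auto simp: ess_bounded_def err_def[abs_def] cong: measurable_cong AE_cong)
  qed
  show "integrable M (\<lambda>w. (norm (err i (Suc t) w))\<^sup>2)"
    by (intro ess_bounded_integrable ess_bounded_norm_sq eb)
  have pw: "(norm (err i (Suc t) w))\<^sup>2 \<le> 3 * ((1 / (real H)\<^sup>2) * (norm (\<Sum>l<H. noise i t l w))\<^sup>2
      + (1 / real H) * (\<Sum>l<H. L\<^sup>2 * ?Y i l w) + (1 / real n) * (\<Sum>j<n. L\<^sup>2 * ?Y j H w))"
    if w: "w \<in> space M" for w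
  proof -
    have 1: "(norm ((1 / real H) *\<^sub>R (\<Sum>l<H. noise i t l w)))\<^sup>2 = (1 / (real H)\<^sup>2) * (norm (\<Sum>l<H. noise i t l w))\<^sup>2"
      by (simp add: power_divide)
    have 2: "(norm ((1 / real H) *\<^sub>R (\<Sum>l<H. grad (Fi i) (y i t l w) - grad (Fi i) (x t w))))\<^sup>2
        \<le> (1 / real H) * (\<Sum>l<H. L\<^sup>2 * ?Y i l w)"
    proof -
      have "(norm (grad (Fi i) (y i t l w) - grad (Fi i) (x t w)))\<^sup>2 \<le> L\<^sup>2 * ?Y i l w" for l
        using power_mono[OF L_smooth_lipschitz[OF smooth_Fi[OF i], of "y i t l w" "x t w"], of 2]
        by (simp add: power_mult_distrib)
      then have "(1 / real H) * (\<Sum>l<H. (norm (grad (Fi i) (y i t l w) - grad (Fi i) (x t w)))\<^sup>2)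
          \<le> (1 / real H) * (\<Sum>l<H. L\<^sup>2 * ?Y i l w)"
        by (intro mult_left_mono sum_mono) auto
      then show ?thesis
        using norm_average_sq_le[OF sizes(2), of "\<lambda>l. grad (Fi i) (y i t l w) - grad (Fi i) (x t w)"]
        by linarith
    qed
    have 3: "(norm (grad (Fi i) (x t w) - grad (Fi i) (x (Suc t) w)))\<^sup>2
        \<le> (1 / real n) * (\<Sum>j<n. L\<^sup>2 * ?Y j H w)"
    proof -
      have "(norm (grad (Fi i) (x t w) - grad (Fi i) (x (Suc t) w)))\<^sup>2 \<le> (L * norm (x t w - x (Suc t) w))\<^sup>2"
        by (intro power_mono L_smooth_lipschitz smooth_Fi i) simp
      also have "\<dots> = L\<^sup>2 * (norm (x (Suc t) w - x t w))\<^sup>2"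
        by (simp add: power_mult_distrib norm_minus_commute)
      also have "\<dots> \<le> L\<^sup>2 * ((1 / real n) * (\<Sum>j<n. ?Y j H w))"
        by (intro mult_left_mono x_step_sq_le w) simp
      finally show ?thesis by (simp add: sum_distrib_left)
    qed
    show ?thesis
      unfolding err_Suc_eq[OF i w]
      by (rule order_trans[OF norm_add3_sq_le])
        (rule mult_left_mono[OF add_mono[OF add_mono[OF eq_refl[OF 1] 2] 3]], simp)
  qed
  have i1: "integrable M (\<lambda>w. (1 / (real H)\<^sup>2) * (norm (\<Sum>l<H. noise i t l w))\<^sup>2)"
    using i by (intro integrable_mult_right ess_bounded_integrable ess_bounded_norm_sq
        noise_sum_ess_bounded) auto
  have i2: "integrable M (\<lambda>w. (1 / real H) * (\<Sum>l<H. L\<^sup>2 * ?Y i l w))"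
    using i by (intro integrable_mult_right Bochner_Integration.integrable_sum drift_integrable) auto
  have i3: "integrable M (\<lambda>w. (1 / real n) * (\<Sum>j<n. L\<^sup>2 * ?Y j H w))"
    by (intro integrable_mult_right Bochner_Integration.integrable_sum drift_integrable) auto
  note i12 = Bochner_Integration.integrable_add[OF i1 i2]
  have "(\<integral>w. (norm (err i (Suc t) w))\<^sup>2 \<partial>M)
    \<le> (\<integral>w. 3 * ((1 / (real H)\<^sup>2) * (norm (\<Sum>l<H. noise i t l w))\<^sup>2
      + (1 / real H) * (\<Sum>l<H. L\<^sup>2 * ?Y i l w) + (1 / real n) * (\<Sum>j<n. L\<^sup>2 * ?Y j H w)) \<partial>M)"
    using pw by (intro integral_mono integrable_mult_right Bochner_Integration.integrable_add i1 i2 i3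
        ess_bounded_integrable ess_bounded_norm_sq eb)
  also have "\<dots> = 3 * ((\<integral>w. (1 / (real H)\<^sup>2) * (norm (\<Sum>l<H. noise i t l w))\<^sup>2 \<partial>M)
      + (\<integral>w. (1 / real H) * (\<Sum>l<H. L\<^sup>2 * ?Y i l w) \<partial>M)
      + (\<integral>w. (1 / real n) * (\<Sum>j<n. L\<^sup>2 * ?Y j H w) \<partial>M))"
    by (subst integral_mult_right_zero, subst Bochner_Integration.integral_add[OF i12 i3],
        subst Bochner_Integration.integral_add[OF i1 i2]) (rule refl)
  also have "\<dots> \<le> 3 * (sigma2 + drift_bound t Q + drift_bound t Q)"
  proof (intro mult_left_mono add_mono)
    have "(\<integral>w. (1 / (real H)\<^sup>2) * (norm (\<Sum>l<H. noise i t l w))\<^sup>2 \<partial>M)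
        \<le> (1 / (real H)\<^sup>2) * (real H * (v2 / real b))"
      unfolding integral_mult_right_zero
      by (intro mult_left_mono noise_node_sum_second_moment i) auto
    also have "\<dots> = sigma2" using sizes by (simp add: sigma2_def power2_eq_square)
    finally show "(\<integral>w. (1 / (real H)\<^sup>2) * (norm (\<Sum>l<H. noise i t l w))\<^sup>2 \<partial>M) \<le> sigma2" .
    have "(\<integral>w. (1 / real H) * (\<Sum>l<H. L\<^sup>2 * ?Y i l w) \<partial>M)
        = (1 / real H) * (\<Sum>l<H. L\<^sup>2 * (\<integral>w. ?Y i l w \<partial>M))"
      using i by (subst integral_mult_right_zero, subst Bochner_Integration.integral_sum)
        (auto intro: drift_integrable)
    also have "\<dots> \<le> (1 / real H) * (\<Sum>l<H. drift_bound t Q)"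
      by (intro mult_left_mono sum_mono drift_le[OF Q i]) auto
    finally show "(\<integral>w. (1 / real H) * (\<Sum>l<H. L\<^sup>2 * ?Y i l w) \<partial>M) \<le> drift_bound t Q"
      using sizes by simp
    have "(\<integral>w. (1 / real n) * (\<Sum>j<n. L\<^sup>2 * ?Y j H w) \<partial>M)
        = (1 / real n) * (\<Sum>j<n. L\<^sup>2 * (\<integral>w. ?Y j H w \<partial>M))"
      by (subst integral_mult_right_zero, subst Bochner_Integration.integral_sum)
        (auto intro: drift_integrable)
    also have "\<dots> \<le> (1 / real n) * (\<Sum>j<n. drift_bound t Q)"
      by (intro mult_left_mono sum_mono drift_le[OF Q]) auto
    finally show "(\<integral>w. (1 / real n) * (\<Sum>j<n. L\<^sup>2 * ?Y j H w) \<partial>M) \<le> drift_bound t Q"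
      using sizes by simp
  qed auto
  also have "\<dots> \<le> A_q H b v2 + B_q L \<theta> * gap t + C_q \<theta> * Q"
  proof -
    have "3 * (sigma2 + drift_bound t Q + drift_bound t Q)
        = 3 * sigma2 + 18 * \<theta>\<^sup>2 * sigma2 + 144 * \<theta>\<^sup>2 * Q + B_q L \<theta> * gap t"
      by (simp add: drift_bound_def B_q_def algebra_simps)
    moreover have "18 * \<theta>\<^sup>2 * sigma2 \<le> 3 * sigma2"
      using amplitude sigma2_nonneg by (intro mult_right_mono) auto
    moreover have "144 * \<theta>\<^sup>2 * Q \<le> C_q \<theta> * Q"
      using err_bound_nonneg[OF Q] by (intro mult_right_mono) (auto simp: C_q_def)
    moreover have "A_q H b v2 = 6 * sigma2" by (simp add: A_q_def sigma2_def)
    ultimately show ?thesis by linarith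
  qed
  finally show "(\<integral>w. (norm (err i (Suc t) w))\<^sup>2 \<partial>M) \<le> A_q H b v2 + B_q L \<theta> * gap t + C_q \<theta> * Q" .
qed

subsection \<open>The objective gap\<close>

lemma cbar_Suc_split:
  assumes w: "w \<in> space M"
  shows "cbar (Suc t) w = (1 / real n) *\<^sub>R (\<Sum>i<n. (1 / real H) *\<^sub>R (\<Sum>l<H. grad (Fi i) (y i t l w)))
    + (1 / (real n * real H)) *\<^sub>R (\<Sum>(i, l)\<in>{..<n} \<times> {..<H}. noise i t l w)"
proof -
  have "cbar (Suc t) w = (1 / real n) *\<^sub>R (\<Sum>i<n. (1 / real H) *\<^sub>R (\<Sum>l<H. sgrad i t l w))"
    using c_Suc_eq[OF _ w, of _ t] by (simp add: cbar_eq[OF w, of "Suc t"])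
  also have "\<dots> = (1 / real n) *\<^sub>R (\<Sum>i<n. (1 / real H) *\<^sub>R (\<Sum>l<H. grad (Fi i) (y i t l w)))
      + (1 / real n) *\<^sub>R (\<Sum>i<n. (1 / real H) *\<^sub>R (\<Sum>l<H. noise i t l w))"
    by (simp add: noise_def sum_subtractf scaleR_diff_right)
  also have "(1 / real n) *\<^sub>R (\<Sum>i<n. (1 / real H) *\<^sub>R (\<Sum>l<H. noise i t l w))
      = (1 / (real n * real H)) *\<^sub>R (\<Sum>(i, l)\<in>{..<n} \<times> {..<H}. noise i t l w)"
    by (simp add: sum.cartesian_product[symmetric] scaleR_sum_right)
  finally show ?thesis .
qed

text \<open>The descent inequality before taking expectations. The noise \<open>S\<close> enters linearly only through
  its inner product with the gradient at the start of the round, which has mean zero.\<close>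

lemma descent_pointwise:
  assumes w: "w \<in> space M"
    and PL: "2 * \<mu> * (F (x t w) - F xstar) \<le> (norm (grad F (x t w)))\<^sup>2"
  defines "S \<equiv> (1 / (real n * real H)) *\<^sub>R (\<Sum>(i, l)\<in>{..<n} \<times> {..<H}. noise i t l w)"
  shows "F (x (Suc t) w) - F xstar
    \<le> (1 - \<mu> * (\<theta> / L)) * (F (x t w) - F xstar) - (\<theta> / L) * inner (grad F (x t w)) S
      + (\<theta> / (2 * L)) * ((1 / real n) * (\<Sum>i<n. (1 / real H) * (\<Sum>l<H. L\<^sup>2 * (norm (y i t l w - x t w))\<^sup>2)))
      + (\<theta>\<^sup>2 / L) * (norm S)\<^sup>2"
proof -
  define u where "u = \<theta> / L"
  have u: "0 < u" "L * u = \<theta>" using amplitude L_pos by (auto simp: u_def)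
  define g0 where "g0 = grad F (x t w)"
  define D where "D = (1 / real n) *\<^sub>R (\<Sum>i<n. (1 / real H) *\<^sub>R (\<Sum>l<H. grad (Fi i) (y i t l w)))"
  \<comment> \<open>The term \<open>(norm D)\<^sup>2\<close> gained by completing the square in \<open>inner g0 D\<close> absorbs the part of the
    quadratic term that is due to \<open>D\<close>, because \<open>\<theta> \<le> 1 / 2\<close>.\<close>
  have step: "x (Suc t) w = x t w + (- u) *\<^sub>R (D + S)"
    unfolding x_Suc_eq[OF w] cbar_Suc_split[OF w] D_def S_def u_def by simp
  have "F (x (Suc t) w) \<le> F (x t w) + inner g0 ((- u) *\<^sub>R (D + S)) + L / 2 * (norm ((- u) *\<^sub>R (D + S)))\<^sup>2"
    unfolding step g0_def by (rule descent_lemma[OF smooth_F])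
  also have "inner g0 ((- u) *\<^sub>R (D + S)) = - u * inner g0 S
      - u / 2 * (norm g0)\<^sup>2 + u / 2 * (norm (D - g0))\<^sup>2 - u / 2 * (norm D)\<^sup>2"
    by (simp add: power2_norm_eq_inner inner_add_right inner_diff_left inner_diff_right
        inner_commute[of D g0] algebra_simps)
  also have "L / 2 * (norm ((- u) *\<^sub>R (D + S)))\<^sup>2 = u * \<theta> / 2 * (norm (D + S))\<^sup>2"
    unfolding u(2)[symmetric] by (simp add: power_mult_distrib power2_eq_square)
  also have "u * \<theta> / 2 * (norm (D + S))\<^sup>2 \<le> u * \<theta> / 2 * (2 * (norm D)\<^sup>2 + 2 * (norm S)\<^sup>2)"
    using u amplitude by (intro mult_left_mono norm_add_sq_le) auto
  also have "\<dots> = \<theta> * (u * (norm D)\<^sup>2) + u * \<theta> * (norm S)\<^sup>2" by (simp add: algebra_simps)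
  also have "\<theta> * (u * (norm D)\<^sup>2) \<le> 1 / 2 * (u * (norm D)\<^sup>2)"
    using theta_le_half u by (intro mult_right_mono) auto
  finally have "F (x (Suc t) w) \<le> F (x t w) - u * inner g0 S - u / 2 * (norm g0)\<^sup>2
      + u / 2 * (norm (D - g0))\<^sup>2 + u * \<theta> * (norm S)\<^sup>2"
    by simp
  moreover have "u / 2 * (2 * \<mu> * (F (x t w) - F xstar)) \<le> u / 2 * (norm g0)\<^sup>2"
    using PL u by (intro mult_left_mono) (auto simp: g0_def)
  moreover have "u / 2 * (norm (D - g0))\<^sup>2
      \<le> u / 2 * ((1 / real n) * (\<Sum>i<n. (1 / real H) * (\<Sum>l<H. L\<^sup>2 * (norm (y i t l w - x t w))\<^sup>2)))"
  proof (rule mult_left_mono)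
    have Dg: "D - g0 = (1 / real n) *\<^sub>R (\<Sum>i<n. (1 / real H) *\<^sub>R (\<Sum>l<H. grad (Fi i) (y i t l w) - grad (Fi i) (x t w)))"
      using sizes by (simp add: D_def g0_def grad_F sum_subtractf scaleR_diff_right sum_constant_scaleR
          del: sum_constant)
    have "(norm (D - g0))\<^sup>2
        \<le> (1 / real n) * (\<Sum>i<n. (norm ((1 / real H) *\<^sub>R (\<Sum>l<H. grad (Fi i) (y i t l w) - grad (Fi i) (x t w))))\<^sup>2)"
      unfolding Dg by (rule norm_average_sq_le[OF sizes(1)])
    also have "\<dots> \<le> (1 / real n) * (\<Sum>i<n. (1 / real H) * (\<Sum>l<H. (norm (grad (Fi i) (y i t l w) - grad (Fi i) (x t w)))\<^sup>2))"
      by (intro mult_left_mono sum_mono norm_average_sq_le[OF sizes(2)]) auto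
    also have "\<dots> \<le> (1 / real n) * (\<Sum>i<n. (1 / real H) * (\<Sum>l<H. L\<^sup>2 * (norm (y i t l w - x t w))\<^sup>2))"
    proof (intro mult_left_mono sum_mono)
      fix i l assume "i \<in> {..<n}"
      then show "(norm (grad (Fi i) (y i t l w) - grad (Fi i) (x t w)))\<^sup>2 \<le> L\<^sup>2 * (norm (y i t l w - x t w))\<^sup>2"
        using power_mono[OF L_smooth_lipschitz[OF smooth_Fi, of i "y i t l w" "x t w"], of 2]
        by (simp add: power_mult_distrib)
    qed auto
    finally show "(norm (D - g0))\<^sup>2
      \<le> (1 / real n) * (\<Sum>i<n. (1 / real H) * (\<Sum>l<H. L\<^sup>2 * (norm (y i t l w - x t w))\<^sup>2))" .
  qed (use u in simp)
  moreover have "u / 2 * (2 * \<mu> * (F (x t w) - F xstar)) = \<mu> * u * (F (x t w) - F xstar)" by simp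
  moreover have "(1 - \<mu> * u) * (F (x t w) - F xstar) = F (x t w) - F xstar - \<mu> * u * (F (x t w) - F xstar)"
    by (simp add: algebra_simps)
  ultimately have "F (x (Suc t) w) - F xstar
    \<le> (1 - \<mu> * u) * (F (x t w) - F xstar) - u * inner g0 S
      + u / 2 * ((1 / real n) * (\<Sum>i<n. (1 / real H) * (\<Sum>l<H. L\<^sup>2 * (norm (y i t l w - x t w))\<^sup>2)))
      + u * \<theta> * (norm S)\<^sup>2"
    by argo
  then show ?thesis by (simp add: g0_def u_def power2_eq_square mult.commute)
qed

lemma gap_recursion:
  assumes Q: "err_bound t Q"
    and PL: "AE w in M. 2 * \<mu> * (F (x t w) - F xstar) \<le> (norm (grad F (x t w)))\<^sup>2"
  shows "gap (Suc t) \<le> (1 - a_PL \<mu> L \<theta> n) * gap t + gamma_dir L \<theta> n * Q + delta_dir L \<theta> n H b v2"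
proof -
  define S where "S w = (1 / (real n * real H)) *\<^sub>R (\<Sum>(i, l)\<in>{..<n} \<times> {..<H}. noise i t l w)" for w
  define Y where "Y w = (1 / real n) * (\<Sum>i<n. (1 / real H) * (\<Sum>l<H. L\<^sup>2 * (norm (y i t l w - x t w))\<^sup>2))" for w
  have S_bd: "ess_bounded M S"
    unfolding S_def[abs_def] by (intro ess_bounded_scaleR ess_bounded_sum) (auto intro: noise_ess_bounded)
  have g_bd: "ess_bounded M (\<lambda>w. grad F (x t w))"
    by (intro grad_ess_bounded smooth_F x_ess_bounded)
  have iG: "integrable M (\<lambda>w. (1 - \<mu> * (\<theta> / L)) * (F (x t w) - F xstar))"
    by (intro integrable_mult_right gap_integrable)
  have iI: "integrable M (\<lambda>w. (\<theta> / L) * inner (grad F (x t w)) (S w))"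
    by (intro integrable_mult_right ess_bounded_integrable ess_bounded_inner g_bd S_bd)
  have iY: "integrable M Y"
    unfolding Y_def[abs_def]
    by (intro integrable_mult_right Bochner_Integration.integrable_sum drift_integrable) auto
  have iY': "integrable M (\<lambda>w. (\<theta> / (2 * L)) * Y w)" using iY by (rule integrable_mult_right)
  have iS: "integrable M (\<lambda>w. (\<theta>\<^sup>2 / L) * (norm (S w))\<^sup>2)"
    by (intro integrable_mult_right ess_bounded_integrable ess_bounded_norm_sq S_bd)
  have inner0: "(\<integral>w. inner (grad F (x t w)) (S w) \<partial>M) = 0"
  proof -
    have n0: "(\<integral>w. inner (grad F (x t w)) (noise i t l w) \<partial>M) = 0" if "i < n" "l < H" for i l
      using that by (intro noise_orthogonal g_bd grad_measurable smooth_F state_measurable_step)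
    have "(\<integral>w. inner (grad F (x t w)) (S w) \<partial>M)
        = (1 / (real n * real H)) * (\<integral>w. (\<Sum>p\<in>{..<n} \<times> {..<H}. inner (grad F (x t w)) (noise (fst p) t (snd p) w)) \<partial>M)"
      by (simp add: S_def case_prod_beta inner_sum_right)
    also have "(\<integral>w. (\<Sum>p\<in>{..<n} \<times> {..<H}. inner (grad F (x t w)) (noise (fst p) t (snd p) w)) \<partial>M)
        = (\<Sum>p\<in>{..<n} \<times> {..<H}. \<integral>w. inner (grad F (x t w)) (noise (fst p) t (snd p) w) \<partial>M)"
      by (intro Bochner_Integration.integral_sum ess_bounded_integrable ess_bounded_inner g_bd
          noise_ess_bounded) auto
    also have "\<dots> = 0" using n0 by (intro sum.neutral) auto
    finally show ?thesis by simp
  qed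
  have S2: "(\<integral>w. (norm (S w))\<^sup>2 \<partial>M) \<le> sigma2 / real n"
  proof -
    have "(\<integral>w. (norm (S w))\<^sup>2 \<partial>M)
        = (1 / (real n * real H))\<^sup>2 * (\<integral>w. (norm (\<Sum>(i, l)\<in>{..<n} \<times> {..<H}. noise i t l w))\<^sup>2 \<partial>M)"
      by (simp add: S_def power_mult_distrib power_divide)
    also have "\<dots> \<le> (1 / (real n * real H))\<^sup>2 * (real (card ({..<n} \<times> {..<H})) * (v2 / real b))"
      by (intro mult_left_mono noise_sum_second_moment) auto
    also have "\<dots> = sigma2 / real n"
      using sizes by (simp add: sigma2_def power2_eq_square)
    finally show ?thesis .
  qed
  have Y_le: "(\<integral>w. Y w \<partial>M) \<le> drift_bound t Q"
  proof -
    have "(\<integral>w. Y w \<partial>M) = (1 / real n) * (\<Sum>i<n. (1 / real H) * (\<Sum>l<H. L\<^sup>2 * (\<integral>w. (norm (y i t l w - x t w))\<^sup>2 \<partial>M)))"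
      unfolding Y_def integral_mult_right_zero
      by (subst Bochner_Integration.integral_sum)
        (auto intro!: Bochner_Integration.integrable_sum integrable_mult_right drift_integrable
          sum.cong simp: Bochner_Integration.integral_sum drift_integrable)
    also have "\<dots> \<le> (1 / real n) * (\<Sum>i<n. (1 / real H) * (\<Sum>l<H. drift_bound t Q))"
      by (intro mult_left_mono sum_mono drift_le[OF Q]) auto
    also have "\<dots> = drift_bound t Q" using sizes by simp
    finally show ?thesis .
  qed
  note i1 = Bochner_Integration.integrable_diff[OF iG iI]
  note i2 = Bochner_Integration.integrable_add[OF i1 iY']
  have "gap (Suc t) \<le> (\<integral>w. (1 - \<mu> * (\<theta> / L)) * (F (x t w) - F xstar) - (\<theta> / L) * inner (grad F (x t w)) (S w)
      + (\<theta> / (2 * L)) * Y w + (\<theta>\<^sup>2 / L) * (norm (S w))\<^sup>2 \<partial>M)"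
    unfolding gap_def
  proof (rule integral_mono_AE[OF gap_integrable Bochner_Integration.integrable_add[OF i2 iS]])
    show "AE w in M. F (x (Suc t) w) - F xstar
        \<le> (1 - \<mu> * (\<theta> / L)) * (F (x t w) - F xstar) - (\<theta> / L) * inner (grad F (x t w)) (S w)
      + (\<theta> / (2 * L)) * Y w + (\<theta>\<^sup>2 / L) * (norm (S w))\<^sup>2"
      using PL AE_space by eventually_elim (unfold S_def Y_def, rule descent_pointwise)
  qed
  also have "\<dots> = (1 - \<mu> * (\<theta> / L)) * gap t - (\<theta> / L) * (\<integral>w. inner (grad F (x t w)) (S w) \<partial>M)
      + (\<theta> / (2 * L)) * (\<integral>w. Y w \<partial>M) + (\<theta>\<^sup>2 / L) * (\<integral>w. (norm (S w))\<^sup>2 \<partial>M)"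
    unfolding Bochner_Integration.integral_add[OF i2 iS] Bochner_Integration.integral_add[OF i1 iY']
      Bochner_Integration.integral_diff[OF iG iI] gap_def
    by (simp only: integral_mult_right_zero)
  also have "\<dots> \<le> (1 - \<mu> * (\<theta> / L)) * gap t - (\<theta> / L) * 0
      + (\<theta> / (2 * L)) * drift_bound t Q + (\<theta>\<^sup>2 / L) * (sigma2 / real n)"
    unfolding inner0 using Y_le S2 amplitude L_pos by (intro add_mono mult_left_mono order_refl) auto
  also have "\<dots> = (1 - \<mu> * (\<theta> / L)) * gap t + 12 * \<theta> ^ 3 * gap t + 12 * \<theta> ^ 3 / L * Q
      + (3 / 2 * \<theta> ^ 3 + \<theta>\<^sup>2 / real n) * (sigma2 / L)"
    using L_pos by (simp add: drift_bound_def power3_eq_cube power2_eq_square field_simps)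
  also have "\<dots> \<le> (1 - \<mu> * (\<theta> / L)) * gap t + beta_dir \<theta> n * gap t + gamma_dir L \<theta> n * Q
      + delta_dir L \<theta> n H b v2"
  proof (intro add_mono order_refl)
    show "12 * \<theta> ^ 3 * gap t \<le> beta_dir \<theta> n * gap t"
      using amplitude gap_expectation_nonneg by (intro mult_right_mono) (auto simp: beta_dir_def)
    have "12 * \<theta> ^ 3 / L \<le> 96 * \<theta> ^ 3 / L" using amplitude L_pos by (intro divide_right_mono) auto
    also have "\<dots> \<le> gamma_dir L \<theta> n" using amplitude L_pos by (simp add: gamma_dir_def)
    finally show "12 * \<theta> ^ 3 / L * Q \<le> gamma_dir L \<theta> n * Q"
      using err_bound_nonneg[OF Q] by (intro mult_right_mono) auto
    have "(3 / 2 * \<theta> ^ 3 + \<theta>\<^sup>2 / real n) * (sigma2 / L) \<le> (16 * \<theta> ^ 3 + 16 * \<theta>\<^sup>2 / real n) * (sigma2 / L)"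
      using amplitude L_pos sigma2_nonneg
      by (intro mult_right_mono add_mono divide_right_mono) auto
    also have "\<dots> = delta_dir L \<theta> n H b v2"
      by (simp add: delta_dir_def sigma2_def mult.commute mult.left_commute)
    finally show "(3 / 2 * \<theta> ^ 3 + \<theta>\<^sup>2 / real n) * (sigma2 / L) \<le> delta_dir L \<theta> n H b v2" .
  qed
  also have "\<dots> = (1 - a_PL \<mu> L \<theta> n) * gap t + gamma_dir L \<theta> n * Q + delta_dir L \<theta> n H b v2"
    by (simp add: a_PL_def algebra_simps)
  finally show ?thesis .
qed

end

section \<open>The Lyapunov recursion\<close>

context controller_run
begin

lemma err_measurable: "i < n \<Longrightarrow> err i t \<in> borel_measurable M"
  unfolding err_def[abs_def]
  by (intro borel_measurable_diff state_measurable_M grad_measurable smooth_Fi)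

lemma max_mean_sq_nonneg: "0 \<le> max_mean_sq M n err t"
proof -
  have "0 \<le> enn2ereal (\<integral>\<^sup>+w. ennreal ((norm (err 0 t w))\<^sup>2) \<partial>M)" by simp
  also have "\<dots> \<le> max_mean_sq M n err t"
    unfolding max_mean_sq_def using sizes by (intro Max_ge) auto
  finally show ?thesis .
qed

lemma max_mean_sq_le:
  assumes Q: "err_bound t Q"
  shows "max_mean_sq M n err t \<le> ereal Q"
  unfolding max_mean_sq_def
proof (rule Max.boundedI)
  fix a assume "a \<in> (\<lambda>i. enn2ereal (\<integral>\<^sup>+w. ennreal ((norm (err i t w))\<^sup>2) \<partial>M)) ` {..<n}"
  then obtain i where i: "i < n" and a: "a = enn2ereal (\<integral>\<^sup>+w. ennreal ((norm (err i t w))\<^sup>2) \<partial>M)"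
    by auto
  have "integrable M (\<lambda>w. (norm (err i t w))\<^sup>2)" "(\<integral>w. (norm (err i t w))\<^sup>2 \<partial>M) \<le> Q"
    using Q i by (auto simp: err_bound_def)
  then show "a \<le> ereal Q"
    unfolding a by (simp add: nn_integral_eq_integral enn2ereal_ennreal)
qed (use sizes in auto)

lemma err_bound_max_mean_sq:
  assumes q: "max_mean_sq M n err t = ereal Q"
  shows "err_bound t Q"
  unfolding err_bound_def
proof (intro allI impI)
  fix i assume i: "i < n"
  let ?N = "\<integral>\<^sup>+w. ennreal ((norm (err i t w))\<^sup>2) \<partial>M"
  have le: "enn2ereal ?N \<le> ereal Q"
    unfolding q[symmetric] max_mean_sq_def using i by (intro Max_ge) auto
  have Q0: "0 \<le> Q" using max_mean_sq_nonneg[of t] q by simp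
  have N: "?N \<le> ennreal Q"
    using le Q0 by (simp add: less_eq_ennreal.rep_eq enn2ereal_ennreal)
  have int: "integrable M (\<lambda>w. (norm (err i t w))\<^sup>2)"
    using N err_measurable[OF i] by (intro integrableI_nonneg) (auto intro: le_less_trans)
  moreover have "(\<integral>w. (norm (err i t w))\<^sup>2 \<partial>M) \<le> Q"
    using N Q0 int by (simp add: nn_integral_eq_integral)
  ultimately show "integrable M (\<lambda>w. (norm (err i t w))\<^sup>2) \<and> (\<integral>w. (norm (err i t w))\<^sup>2 \<partial>M) \<le> Q" ..
qed

text \<open>If the control error has infinite second moment, which can only happen at round 0, the right
  hand side is infinite.\<close>

lemma lyapunov_recursion:
  assumes adm: "PL_admissible \<mu> L \<theta> n"
    and PL: "AE w in M. 2 * \<mu> * (F (x t w) - F xstar) \<le> (norm (grad F (x t w)))\<^sup>2"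
  defines "\<rho> \<equiv> rho_PL \<mu> L \<theta> n" and "lam \<equiv> lambda_PL \<mu> L \<theta> n"
  shows "ereal (gap (Suc t)) + ereal lam * max_mean_sq M n err (Suc t)
    \<le> ereal (1 - \<rho>) * (ereal (gap t) + ereal lam * max_mean_sq M n err t)
      + ereal (delta_dir L \<theta> n H b v2 + lam * A_q H b v2)"
proof (cases "max_mean_sq M n err t")
  case (real Q)
  have lam: "0 < lam" unfolding lam_def using lambda_PL_pos L_pos amplitude adm by blast
  have Q: "err_bound t Q" by (rule err_bound_max_mean_sq[OF real])
  have q': "max_mean_sq M n err (Suc t) \<le> ereal (A_q H b v2 + B_q L \<theta> * gap t + C_q \<theta> * Q)"
    by (rule max_mean_sq_le[OF err_recursion[OF Q]])
  have "ereal (gap (Suc t)) + ereal lam * max_mean_sq M n err (Suc t)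
      \<le> ereal ((1 - a_PL \<mu> L \<theta> n) * gap t + gamma_dir L \<theta> n * Q + delta_dir L \<theta> n H b v2)
        + ereal lam * ereal (A_q H b v2 + B_q L \<theta> * gap t + C_q \<theta> * Q)"
    using gap_recursion[OF Q PL] q' lam by (intro add_mono ereal_mult_left_mono) auto
  also have "\<dots> = ereal ((1 - a_PL \<mu> L \<theta> n + lam * B_q L \<theta>) * gap t
      + (gamma_dir L \<theta> n + lam * C_q \<theta>) * Q + (delta_dir L \<theta> n H b v2 + lam * A_q H b v2))"
    by (simp add: algebra_simps)
  also have "1 - a_PL \<mu> L \<theta> n + lam * B_q L \<theta> = 1 - \<rho>"
    unfolding \<rho>_def lam_def using rho_PL_eq[OF L_pos amplitude(1) adm] by simp
  also have "gamma_dir L \<theta> n + lam * C_q \<theta> = (1 - \<rho>) * lam"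
    unfolding \<rho>_def lam_def by (rule lambda_PL_eigen[OF L_pos amplitude(1) adm])
  finally show ?thesis by (simp add: real algebra_simps)
next
  case PInf
  have "0 < lam" "\<rho> < 1"
    unfolding lam_def \<rho>_def using lambda_PL_pos rho_PL_less_1 L_pos amplitude adm by blast+
  then show ?thesis by (simp add: PInf)
next
  case MInf
  then show ?thesis using max_mean_sq_nonneg[of t] by simp
qed

end

lemma ereal_affine_recursion:
  fixes s :: "nat \<Rightarrow> ereal" and \<rho> d :: real
  assumes step: "\<And>t. s (Suc t) \<le> ereal (1 - \<rho>) * s t + ereal d"
    and \<rho>: "0 < \<rho>" "\<rho> < 1" and d: "0 \<le> d" and s0: "0 \<le> s 0"
  shows "s t \<le> ereal ((1 - \<rho>) ^ t) * s 0 + ereal (d / \<rho>)"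
proof (cases "s 0")
  case (real r)
  have "s t \<le> ereal ((1 - \<rho>) ^ t * r + d / \<rho>)"
  proof (induction t)
    case 0
    show ?case using d \<rho> by (simp add: real)
  next
    case (Suc t)
    have "s (Suc t) \<le> ereal (1 - \<rho>) * s t + ereal d" by (rule step)
    also have "\<dots> \<le> ereal (1 - \<rho>) * ereal ((1 - \<rho>) ^ t * r + d / \<rho>) + ereal d"
      using Suc \<rho> by (intro add_mono ereal_mult_left_mono) auto
    also have "\<dots> = ereal ((1 - \<rho>) ^ Suc t * r + d / \<rho>)"
      using \<rho> by (simp add: field_simps)
    finally show ?case .
  qed
  then show ?thesis by (simp add: real)
next
  case PInf
  then show ?thesis using \<rho> by simp
next
  case MInf
  then show ?thesis using s0 by simp
qed

section \<open>Linear convergence under the Polyak-Lojasiewicz condition\<close>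

theorem theorem3p3:
  fixes M :: "'w measure"
    and n H b :: nat and m :: "nat \<Rightarrow> nat"
    and \<phi> :: "nat \<Rightarrow> nat \<Rightarrow> real ^ 'd \<Rightarrow> real"
    and L R \<theta> \<mu> :: real and xstar :: "real ^ 'd"
    and Bat :: "nat \<Rightarrow> nat \<Rightarrow> nat \<Rightarrow> 'w \<Rightarrow> nat set"
    and x :: "nat \<Rightarrow> 'w \<Rightarrow> real ^ 'd"
    and y :: "nat \<Rightarrow> nat \<Rightarrow> nat \<Rightarrow> 'w \<Rightarrow> real ^ 'd"
    and c :: "nat \<Rightarrow> nat \<Rightarrow> 'w \<Rightarrow> real ^ 'd"
    and cbar :: "nat \<Rightarrow> 'w \<Rightarrow> real ^ 'd"
  defines "Fi \<equiv> node_obj m \<phi>"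
    and "F \<equiv> global_obj n m \<phi>"
    and "v2 \<equiv> max_var n m \<phi> xstar R"
    and "\<eta> \<equiv> \<theta> / (L * real H)"
    and "gr \<equiv> \<lambda>i t l w. (1 / real b) *\<^sub>R (\<Sum>j\<in>Bat i t l w. grad (\<phi> i j) (y i t l w))"
    and "G \<equiv> step_algebra M n H (x 0) (\<lambda>i. c i 0) Bat"
    and "\<rho> \<equiv> rho_PL \<mu> L \<theta> n"
    and "lam \<equiv> lambda_PL \<mu> L \<theta> n"
  defines "e \<equiv> \<lambda>i t w. c i t w - grad (Fi i) (x t w)"
    and "g \<equiv> obj_gap M F xstar x"
    and "\<delta> \<equiv> delta_dir L \<theta> n H b v2"
    and "Aq \<equiv> A_q H b v2"
  defines "q \<equiv> max_mean_sq M n e"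
  defines "s \<equiv> \<lambda>t. ereal (g t) + ereal lam * q t"
  assumes prob: "prob_space M"
    and sizes: "0 < n" "0 < H" "0 < b" "\<And>i. i < n \<Longrightarrow> 0 < m i"
    and pos: "0 < L" "0 < R" "0 < \<mu>"
    and amplitude: "0 < \<theta>" "\<theta> \<le> 1" "288 * \<theta>\<^sup>2 < 1"
    and convex: "\<And>i j. i < n \<Longrightarrow> j < m i \<Longrightarrow> convex_on UNIV (\<phi> i j)"
    and smooth: "\<And>i j. i < n \<Longrightarrow> j < m i \<Longrightarrow> L_smooth L (\<phi> i j)"
    and minimizer: "\<And>z. F xstar \<le> F z"
    and init_measurable: "x 0 \<in> borel_measurable M" "\<And>i. i < n \<Longrightarrow> c i 0 \<in> borel_measurable M"
    and batch_measurable: "\<And>i t l. i < n \<Longrightarrow> l < H \<Longrightarrow> Bat i t l \<in> M \<rightarrow>\<^sub>M count_space UNIV"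
    and batch_size: "\<And>i t l w. i < n \<Longrightarrow> l < H \<Longrightarrow> w \<in> space M \<Longrightarrow>
        Bat i t l w \<subseteq> {..<m i} \<and> card (Bat i t l w) = b"
    and cbar_0: "\<And>w. w \<in> space M \<Longrightarrow> cbar 0 w = (1 / real n) *\<^sub>R (\<Sum>i<n. c i 0 w)"
    and y_0: "\<And>i t w. i < n \<Longrightarrow> w \<in> space M \<Longrightarrow> y i t 0 w = x t w"
    and y_Suc: "\<And>i t l w. i < n \<Longrightarrow> l < H \<Longrightarrow> w \<in> space M \<Longrightarrow>
        y i t (Suc l) w = y i t l w - \<eta> *\<^sub>R (gr i t l w - c i t w + cbar t w)"
    and c_Suc: "\<And>i t w. i < n \<Longrightarrow> w \<in> space M \<Longrightarrow>
        c i (Suc t) w = c i t w - cbar t w + (1 / (real H * \<eta>)) *\<^sub>R (x t w - y i t H w)"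
    and x_Suc: "\<And>t w. w \<in> space M \<Longrightarrow>
        x (Suc t) w = x t w + (1 / real n) *\<^sub>R (\<Sum>i<n. y i t H w - x t w)"
    and cbar_Suc: "\<And>t w. w \<in> space M \<Longrightarrow>
        cbar (Suc t) w = cbar t w + (1 / real n) *\<^sub>R (\<Sum>i<n. c i (Suc t) w - c i t w)"
    and in_ball: "AE w in M. \<forall>t. x t w \<in> cball xstar R \<and>
        (\<forall>i<n. \<forall>l\<le>H. y i t l w \<in> cball xstar R)"
    and batch_indep: "\<And>i t l. i < n \<Longrightarrow> l < H \<Longrightarrow>
        cond_indep_discrete M (G i t l) (\<lambda>(j, k). Bat j t k) ({..<n} \<times> {..<H})"
    and unbiased: "\<And>i t l. i < n \<Longrightarrow> l < H \<Longrightarrow>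
        AE w in M. vec_cond_exp M (G i t l) (gr i t l) w = grad (Fi i) (y i t l w)"
    and variance: "\<And>i t l. i < n \<Longrightarrow> l < H \<Longrightarrow>
        AE w in M. real_cond_exp M (G i t l)
            (\<lambda>w. (norm (gr i t l w - grad (Fi i) (y i t l w)))\<^sup>2) w
          \<le> node_var m \<phi> xstar R i / real b"
    and PL: "AE w in M. \<forall>t. (norm (grad F (x t w)))\<^sup>2 \<ge> 2 * \<mu> * (F (x t w) - F xstar)"
    and admissible: "PL_admissible \<mu> L \<theta> n"
  shows "(\<forall>t. s (Suc t) \<le> ereal (1 - \<rho>) * s t + ereal (\<delta> + lam * Aq)) \<and>
    (\<forall>t. ereal (g t) \<le> ereal ((1 - \<rho>) ^ t) * (ereal (g 0) + ereal lam * q 0)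
                        + ereal ((\<delta> + lam * Aq) / \<rho>)) \<and>
    (PL_regime \<mu> L \<theta> \<longrightarrow> \<rho> \<ge> \<mu> * \<theta> / (8 * L)) \<and>
    (\<exists>K>0. \<forall>(\<mu>::real) (L::real) (\<theta>::real) (v2::real) (n::nat) (H::nat) (b::nat).
       0 < \<mu> \<and> 0 < L \<and> 0 < \<theta> \<and> \<theta> \<le> 1 \<and> 288 * \<theta>\<^sup>2 < 1 \<and> 0 \<le> v2 \<and> 0 < n \<and> 0 < H \<and> 0 < b \<and>
       PL_admissible \<mu> L \<theta> n \<and> PL_regime \<mu> L \<theta> \<longrightarrow>
       (delta_dir L \<theta> n H b v2 + lambda_PL \<mu> L \<theta> n * A_q H b v2) / rho_PL \<mu> L \<theta> n
         \<le> K * (\<theta> * v2 / (\<mu> * real n * real H * real b) + \<theta>\<^sup>2 * v2 / (\<mu> * real H * real b)))"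
proof -
  interpret run: controller_run M n H b m \<phi> L R \<theta> xstar Bat x y c cbar
  proof (intro controller_run.intro controller_run_axioms.intro)
    show "prob_space M" by (rule prob)
    show "\<And>z. global_obj n m \<phi> xstar \<le> global_obj n m \<phi> z"
      using minimizer unfolding F_def .
    show "\<And>i t l w. i < n \<Longrightarrow> l < H \<Longrightarrow> w \<in> space M \<Longrightarrow> Bat i t l w \<subseteq> {..<m i}"
      using batch_size by blast
    show "\<And>i t l w. i < n \<Longrightarrow> l < H \<Longrightarrow> w \<in> space M \<Longrightarrow>
        y i t (Suc l) w = y i t l w - (\<theta> / (L * real H)) *\<^sub>R
          ((1 / real b) *\<^sub>R (\<Sum>j\<in>Bat i t l w. grad (\<phi> i j) (y i t l w)) - c i t w + cbar t w)"
      using y_Suc unfolding \<eta>_def gr_def .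
    show "\<And>i t w. i < n \<Longrightarrow> w \<in> space M \<Longrightarrow>
        c i (Suc t) w = c i t w - cbar t w +
          (1 / (real H * (\<theta> / (L * real H)))) *\<^sub>R (x t w - y i t H w)"
      using c_Suc unfolding \<eta>_def .
    show "\<And>i t l. i < n \<Longrightarrow> l < H \<Longrightarrow>
        cond_indep_discrete M (step_algebra M n H (x 0) (\<lambda>i. c i 0) Bat i t l)
          (\<lambda>(j, k). Bat j t k) ({..<n} \<times> {..<H})"
      using batch_indep unfolding G_def .
    show "\<And>i t l. i < n \<Longrightarrow> l < H \<Longrightarrow>
        AE w in M. vec_cond_exp M (step_algebra M n H (x 0) (\<lambda>i. c i 0) Bat i t l)
            (\<lambda>w. (1 / real b) *\<^sub>R (\<Sum>j\<in>Bat i t l w. grad (\<phi> i j) (y i t l w))) w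
          = grad (node_obj m \<phi> i) (y i t l w)"
      using unbiased unfolding G_def gr_def Fi_def .
    show "\<And>i t l. i < n \<Longrightarrow> l < H \<Longrightarrow>
        AE w in M. real_cond_exp M (step_algebra M n H (x 0) (\<lambda>i. c i 0) Bat i t l)
            (\<lambda>w. (norm ((1 / real b) *\<^sub>R (\<Sum>j\<in>Bat i t l w. grad (\<phi> i j) (y i t l w))
                         - grad (node_obj m \<phi> i) (y i t l w)))\<^sup>2) w
          \<le> node_var m \<phi> xstar R i / real b"
      using variance unfolding G_def gr_def Fi_def .
  qed (fact assms)+
  have e: "e = run.err" unfolding e_def Fi_def by (simp add: fun_eq_iff run.err_def)
  have g: "g = run.gap" unfolding g_def F_def by (simp add: fun_eq_iff obj_gap_def run.gap_def)
  have pos_rates: "0 < \<rho>" "\<rho> < 1" "0 < lam"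
    unfolding \<rho>_def lam_def
    using rho_PL_pos rho_PL_less_1 lambda_PL_pos pos(1) amplitude(1) admissible by blast+
  have step: "s (Suc t) \<le> ereal (1 - \<rho>) * s t + ereal (\<delta> + lam * Aq)" for t
  proof -
    have "AE w in M. 2 * \<mu> * (global_obj n m \<phi> (x t w) - global_obj n m \<phi> xstar)
        \<le> (norm (grad (global_obj n m \<phi>) (x t w)))\<^sup>2"
      using PL unfolding F_def by eventually_elim blast
    from run.lyapunov_recursion[OF admissible this] show ?thesis
      unfolding s_def q_def e g \<rho>_def lam_def \<delta>_def Aq_def v2_def .
  qed
  have q_nonneg: "0 \<le> q t" for t
    unfolding q_def e by (rule run.max_mean_sq_nonneg)
  have g_nonneg: "0 \<le> g t" for t
    unfolding g by (rule run.gap_expectation_nonneg)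
  have "0 \<le> v2" unfolding v2_def by (rule run.v2_nonneg)
  then have d_nonneg: "0 \<le> \<delta> + lam * Aq"
    unfolding \<delta>_def Aq_def delta_dir_def A_q_def using pos(1) amplitude(1) pos_rates(3) by simp
  have closed: "ereal (g t) \<le> ereal ((1 - \<rho>) ^ t) * (ereal (g 0) + ereal lam * q 0)
      + ereal ((\<delta> + lam * Aq) / \<rho>)" for t
  proof -
    have "ereal (g t) \<le> s t"
      unfolding s_def using q_nonneg[of t] pos_rates(3) by (simp add: ereal_le_add_self)
    also have "s t \<le> ereal ((1 - \<rho>) ^ t) * s 0 + ereal ((\<delta> + lam * Aq) / \<rho>)"
      using g_nonneg[of 0] q_nonneg[of 0] pos_rates d_nonneg
      by (intro ereal_affine_recursion step) (auto simp: s_def)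
    finally show ?thesis by (simp add: s_def)
  qed
  have regime: "PL_regime \<mu> L \<theta> \<longrightarrow> \<mu> * \<theta> / (8 * L) \<le> \<rho>"
    unfolding \<rho>_def using rho_PL_regime_ge[OF pos(3,1) amplitude(1) sizes(1) admissible] by blast
  show ?thesis
  proof (intro conjI allI exI[of _ 12000000] step closed regime impI)
    fix \<mu> L \<theta> v2 :: real and n H b :: nat
    assume "0 < \<mu> \<and> 0 < L \<and> 0 < \<theta> \<and> \<theta> \<le> 1 \<and> 288 * \<theta>\<^sup>2 < 1 \<and> 0 \<le> v2 \<and> 0 < n \<and> 0 < H \<and> 0 < b \<and>
       PL_admissible \<mu> L \<theta> n \<and> PL_regime \<mu> L \<theta>"
    then show "(delta_dir L \<theta> n H b v2 + lambda_PL \<mu> L \<theta> n * A_q H b v2) / rho_PL \<mu> L \<theta> n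
         \<le> 12000000 * (\<theta> * v2 / (\<mu> * real n * real H * real b) + \<theta>\<^sup>2 * v2 / (\<mu> * real H * real b))"
      by (elim conjE) (rule stationary_term_bound)
  qed simp
qed

end
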